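(* Let $\Gamma$ be a metric graph, $q\in\Gamma$, and $D$ a divisor on $\Gamma$ with $D(p)\ge 0$ for all $p\ne q$. Then $D$ is $q$-reduced if and only if $b_q(D)<b_q(D')$ for every $D'\in|D|_q$ with $D'\ne D$.
   Context: $\Gamma$ is a compact connected metric graph (edges identified with real segments of given positive lengths). $R(\Gamma)$ is the group of continuous piecewise affine functions $\Gamma\to\mathbb{R}$ with integer slopes. $\operatorname{Div}(\Gamma)$ is the free abelian group on the points of $\Gamma$; for $D=\sum a_p(p)$ write $D(p)=a_p$, $\deg D=\sum a_p$, and $\mu_D=\sum a_p\delta_p$. For a continuous piecewise affine $f$, $\Delta(f)=\sum_{p\in\Gamma}\sigma_p(f)(p)$, where $-\sigma_p(f)$ is the sum of the outgoing slopes of $f$ over all tangent directions at $p$. $D\sim D'$ if $D-D'=\Delta(f)$ for some $f\in R(\Gamma)$. $|D|_q=\{E\in\operatorname{Div}(\Gamma):E\sim D,\ E(p)\ge 0\ \forall p\ne q\}$. A divisor $D$ is $q$-reduced if (R1) $D(p)\ge 0$ for all $p\ne q$, and (R2) for every non-constant $f\in R(\Gamma)$ attaining its global maximum at $q$, $D+\Delta(f)\notin|D|_q$. For $q\in\Gamma$, $j_q(x,y)$ is, for fixed $y$, the unique continuous piecewise affine function of $x$ with $\Delta_x j_q(x,y)=\delta_y-\delta_q$ and $j_q(q,y)=0$ (it is jointly continuous). For $D$ of degree $d$, $b_q(D)=\int\!\!\int j_q(x,y)\,d\mu_{D-d(q)}(x)\,dy$, where $dy$ is Lebesgue measure on each edge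 of $\Gamma$. *)

theory Defs
  imports "HOL-Analysis.Analysis"
begin

text \<open>A metric graph is given by a finite combinatorial model: a finite vertex set,
  a finite edge set, endpoint maps and positive edge lengths.  Loops and multiple
  edges are allowed.  Each edge e is identified with the real segment [0, len e],
  0 corresponding to src e and len e to tgt e.\<close>

record ('v, 'e) mgraph =
  verts :: "'v set"
  edges :: "'e set"
  src   :: "'e \<Rightarrow> 'v"
  tgt   :: "'e \<Rightarrow> 'v"
  len   :: "'e \<Rightarrow> real"

definition metric_graph :: "('v, 'e) mgraph \<Rightarrow> bool" where
  "metric_graph G \<longleftrightarrow>
     finite (verts G) \<and> verts G \<noteq> {} \<and> finite (edges G) \<and>
     (\<forall>e\<in>edges G. src G e \<in> verts G \<and> tgt G e \<in> verts G \<and> len G e > 0) \<and>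
     (\<forall>S. S \<subseteq> verts G \<and> S \<noteq> {} \<and>
          (\<forall>e\<in>edges G. src G e \<in> S \<longleftrightarrow> tgt G e \<in> S) \<longrightarrow> S = verts G)"

datatype ('v, 'e) point = Vert 'v | EdgePt 'e real

definition pts :: "('v, 'e) mgraph \<Rightarrow> ('v, 'e) point set" where
  "pts G = Vert ` verts G \<union> {EdgePt e t | e t. e \<in> edges G \<and> 0 < t \<and> t < len G e}"

definition pos :: "('v, 'e) mgraph \<Rightarrow> 'e \<Rightarrow> real \<Rightarrow> ('v, 'e) point" where
  "pos G e t = (if t \<le> 0 then Vert (src G e)
                else if t \<ge> len G e then Vert (tgt G e) else EdgePt e t)"

definition edge_fun :: "('v, 'e) mgraph \<Rightarrow> (('v, 'e) point \<Rightarrow> real) \<Rightarrow> 'e \<Rightarrow> real \<Rightarrow> real" where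
  "edge_fun G f e = (\<lambda>t. f (pos G e t))"

text \<open>Continuous piecewise affine on [a,b] with slopes in S (closed pieces force continuity).\<close>

definition pw_affine :: "real set \<Rightarrow> real \<Rightarrow> real \<Rightarrow> (real \<Rightarrow> real) \<Rightarrow> bool" where
  "pw_affine S a b g \<longleftrightarrow>
     (\<exists>xs :: real list. length xs \<ge> 2 \<and> sorted_wrt (<) xs \<and> hd xs = a \<and> last xs = b \<and>
        (\<forall>i < length xs - 1. \<exists>m c. m \<in> S \<and>
            (\<forall>t \<in> {xs ! i .. xs ! Suc i}. g t = m * t + c)))"

definition cpa :: "('v, 'e) mgraph \<Rightarrow> (('v, 'e) point \<Rightarrow> real) \<Rightarrow> bool" where
  "cpa G f \<longleftrightarrow> (\<forall>e \<in> edges G. pw_affine UNIV 0 (len G e) (edge_fun G f e))"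

definition rational_fun :: "('v, 'e) mgraph \<Rightarrow> (('v, 'e) point \<Rightarrow> real) \<Rightarrow> bool" where
  "rational_fun G f \<longleftrightarrow> (\<forall>e \<in> edges G. pw_affine \<int> 0 (len G e) (edge_fun G f e))"

definition rslope :: "(real \<Rightarrow> real) \<Rightarrow> real \<Rightarrow> real" where
  "rslope g t = (THE m. (g has_real_derivative m) (at_right t))"

definition lslope :: "(real \<Rightarrow> real) \<Rightarrow> real \<Rightarrow> real" where
  "lslope g t = (THE m. (g has_real_derivative m) (at_left t))"

definition out_slopes :: "('v, 'e) mgraph \<Rightarrow> (('v, 'e) point \<Rightarrow> real) \<Rightarrow> ('v, 'e) point \<Rightarrow> real" where
  "out_slopes G f p = (case p of
      Vert v \<Rightarrow> (\<Sum>e\<in>{e \<in> edges G. src G e = v}. rslope (edge_fun G f e) 0)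
               + (\<Sum>e\<in>{e \<in> edges G. tgt G e = v}. - lslope (edge_fun G f e) (len G e))
    | EdgePt e t \<Rightarrow> rslope (edge_fun G f e) t - lslope (edge_fun G f e) t)"

definition lap :: "('v, 'e) mgraph \<Rightarrow> (('v, 'e) point \<Rightarrow> real) \<Rightarrow> ('v, 'e) point \<Rightarrow> real" where
  "lap G f p = (if p \<in> pts G then - out_slopes G f p else 0)"

definition is_divisor :: "('v, 'e) mgraph \<Rightarrow> (('v, 'e) point \<Rightarrow> int) \<Rightarrow> bool" where
  "is_divisor G D \<longleftrightarrow> finite {p. D p \<noteq> 0} \<and> {p. D p \<noteq> 0} \<subseteq> pts G"

definition deg :: "(('v, 'e) point \<Rightarrow> int) \<Rightarrow> int" where
  "deg D = (\<Sum>p\<in>{p. D p \<noteq> 0}. D p)"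

definition lin_equiv :: "('v, 'e) mgraph \<Rightarrow> (('v, 'e) point \<Rightarrow> int) \<Rightarrow> (('v, 'e) point \<Rightarrow> int) \<Rightarrow> bool" where
  "lin_equiv G D D' \<longleftrightarrow>
     (\<exists>f. rational_fun G f \<and> (\<forall>p. real_of_int (D p - D' p) = lap G f p))"

definition linsys :: "('v, 'e) mgraph \<Rightarrow> ('v, 'e) point \<Rightarrow> (('v, 'e) point \<Rightarrow> int)
                        \<Rightarrow> (('v, 'e) point \<Rightarrow> int) set" where
  "linsys G q D = {E. is_divisor G E \<and> lin_equiv G E D \<and> (\<forall>p \<in> pts G - {q}. E p \<ge> 0)}"

definition q_reduced :: "('v, 'e) mgraph \<Rightarrow> ('v, 'e) point \<Rightarrow> (('v, 'e) point \<Rightarrow> int) \<Rightarrow> bool" where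
  "q_reduced G q D \<longleftrightarrow>
     (\<forall>p \<in> pts G - {q}. D p \<ge> 0) \<and>
     (\<forall>f. rational_fun G f \<and> (\<exists>x\<in>pts G. \<exists>y\<in>pts G. f x \<noteq> f y) \<and>
          (\<forall>x\<in>pts G. f x \<le> f q) \<longrightarrow>
          \<not> (\<exists>E \<in> linsys G q D. \<forall>p. real_of_int (E p) = real_of_int (D p) + lap G f p))"

definition jfun :: "('v, 'e) mgraph \<Rightarrow> ('v, 'e) point \<Rightarrow> ('v, 'e) point \<Rightarrow> ('v, 'e) point \<Rightarrow> real" where
  "jfun G q x y = (THE g. cpa G g \<and>
       (\<forall>p \<in> pts G. lap G g p = (if p = y then 1 else 0) - (if p = q then 1 else 0)) \<and>
       g q = 0 \<and> (\<forall>p. p \<notin> pts G \<longrightarrow> g p = 0)) x"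

text \<open>b_q(D) = integral over y (Lebesgue measure on each edge) of
  the integral of j_q(x,y) against mu_{D - d(q)} in x.\<close>

definition bq :: "('v, 'e) mgraph \<Rightarrow> ('v, 'e) point \<Rightarrow> (('v, 'e) point \<Rightarrow> int) \<Rightarrow> real" where
  "bq G q D =
    (let Dq = (\<lambda>p. D p - (if p = q then deg D else 0)) in
     (\<Sum>e \<in> edges G. integral {0 .. len G e}
        (\<lambda>t. \<Sum>x \<in> {x. Dq x \<noteq> 0}. real_of_int (Dq x) * jfun G q x (pos G e t))))"

end

theory Submission
  imports Defs
begin

text \<open>If \<open>E = D + \<Delta>(f)\<close>, self-adjointness of the Laplacian turns the integral of
  \<open>j\<^sub>q(x, y)\<close> against \<open>\<Delta>(f)\<close> into \<open>f(y) - f(q)\<close>, so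
  \<open>b\<^sub>q(E) - b\<^sub>q(D)\<close> is the integral of \<open>f - f(q)\<close> over the graph. It remains to see that
  for reduced \<open>D\<close> and \<open>E\<close> in the linear system \<open>f\<close> attains its minimum at \<open>q\<close>: the truncation
  \<open>min(f, f(q))\<close> has its maximum at \<open>q\<close> and also keeps \<open>D\<close> in the linear system, so it
  is constant. The same self-adjointness makes \<open>j\<^sub>q\<close> symmetric, whence its continuity in
  \<open>y\<close>.\<close>

section \<open>Piecewise affine functions on an interval\<close>

text \<open>\<open>jfun\<close> is a definite description, so existence and uniqueness must be
  proved first. Tent functions produce the point masses inside edges; what remains is a square
  linear system on the vertices. Its Laplacian matrix is singular, constants lying in the kernel, so
  the equation at one vertex is traded for a normalisation and recovered because every Laplacian has
  total mass zero. Uniqueness and invertibility come from the Dirichlet energy: zero energy forces a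
  constant on a connected graph. Self-adjointness is proved without integrating derivatives: the
  energy of an edge is a finite sum over break points, evaluated piece by piece. Break points are
  therefore kept as sets that two functions can share, not as lists of pieces. Continuity in
  \<open>y\<close> matters because splitting \<open>integral\<close> over a difference asks for
  integrability. In the converse direction the difference formula is applied to \<open>-f\<close>: a
  maximum at \<open>q\<close> becomes a minimum, so \<open>D + lap G f\<close> would have a strictly
  smaller \<open>bq\<close>.\<close>

definition affine_off :: "real set \<Rightarrow> real set \<Rightarrow> real \<Rightarrow> real \<Rightarrow> (real \<Rightarrow> real) \<Rightarrow> bool" where
  "affine_off S X a b g \<longleftrightarrow>
     (\<forall>u v. a \<le> u \<and> u < v \<and> v \<le> b \<and> X \<inter> {u<..<v} = {} \<longrightarrow>
        (\<exists>m\<in>S. \<exists>c. \<forall>t\<in>{u..v}. g t = m * t + c))"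

text \<open>The set \<open>X\<close> only has to contain the breaks, so a larger one serves as well
  and two functions can share the union of their break sets. Pieces are closed intervals, which
  builds continuity in.\<close>

lemma affine_off_mono:
  assumes "affine_off S X a b g" "X \<subseteq> Y" "S \<subseteq> T" "a \<le> a'" "b' \<le> b"
  shows "affine_off T Y a' b' g"
  unfolding affine_off_def
proof (intro allI impI)
  fix u v assume "a' \<le> u \<and> u < v \<and> v \<le> b' \<and> Y \<inter> {u<..<v} = {}"
  then have "a \<le> u \<and> u < v \<and> v \<le> b \<and> X \<inter> {u<..<v} = {}" using assms by auto
  then show "\<exists>m\<in>T. \<exists>c. \<forall>t\<in>{u..v}. g t = m * t + c"
    using assms(1,3) unfolding affine_off_def by blast
qed

lemma affine_offE:
  assumes "affine_off S X a b g" "a \<le> u" "u < v" "v \<le> b" "X \<inter> {u<..<v} = {}"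
  obtains m c where "m \<in> S" "\<forall>t\<in>{u..v}. g t = m * t + c"
  using assms unfolding affine_off_def by blast

text \<open>Strong induction on the number of points of \<open>X\<close> strictly inside the
  interval: a cut at such a point leaves fewer in each half.\<close>

lemma finite_subdivision_induct [consumes 2, case_names gap join]:
  fixes a b :: real
  assumes "finite X" "a < b"
    and gap: "\<And>u v. a \<le> u \<Longrightarrow> u < v \<Longrightarrow> v \<le> b \<Longrightarrow> X \<inter> {u<..<v} = {} \<Longrightarrow> P u v"
    and join: "\<And>u c v. a \<le> u \<Longrightarrow> u < c \<Longrightarrow> c < v \<Longrightarrow> v \<le> b \<Longrightarrow> c \<in> X \<Longrightarrow> P u c \<Longrightarrow> P c v \<Longrightarrow> P u v"
  shows "P a b"
proof -
  have "P u v" if "a \<le> u" "u < v" "v \<le> b" for u v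
    using that
  proof (induction "card (X \<inter> {u<..<v})" arbitrary: u v rule: less_induct)
    case less
    show ?case
    proof (cases "X \<inter> {u<..<v} = {}")
      case True
      then show ?thesis using gap less.prems by blast
    next
      case False
      then obtain c where c: "c \<in> X" "u < c" "c < v" by auto
      have "X \<inter> {u<..<c} \<subset> X \<inter> {u<..<v}" "X \<inter> {c<..<v} \<subset> X \<inter> {u<..<v}"
        using c by auto
      then have "card (X \<inter> {u<..<c}) < card (X \<inter> {u<..<v})"
        "card (X \<inter> {c<..<v}) < card (X \<inter> {u<..<v})"
        using \<open>finite X\<close> by (auto intro!: psubset_card_mono)
      then have "P u c" "P c v" using less.hyps less.prems c by auto
      then show ?thesis using join less.prems c by blast
    qed
  qed
  then show ?thesis using \<open>a < b\<close> by blast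
qed

lemma affine_off_if_pw_affine:
  assumes "pw_affine S a b g"
  obtains X where "finite X" "affine_off S X a b g" "a < b"
proof -
  obtain xs where xs: "length xs \<ge> 2" "sorted_wrt (<) xs" "hd xs = a" "last xs = b"
    and pieces: "\<And>i. i < length xs - 1 \<Longrightarrow>
      \<exists>m c. m \<in> S \<and> (\<forall>t \<in> {xs ! i .. xs ! Suc i}. g t = m * t + c)"
    using assms unfolding pw_affine_def by auto
  have "xs \<noteq> []" using xs(1) by auto
  then have ab: "xs ! 0 = a" "xs ! (length xs - 1) = b"
    using xs(3,4) by (simp_all add: hd_conv_nth last_conv_nth)
  have lt: "xs ! i < xs ! j" if "i < j" "j < length xs" for i j
    using xs(2) that by (simp add: sorted_wrt_iff_nth_less)
  have "affine_off S (set xs) a b g"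
    unfolding affine_off_def
  proof (intro allI impI)
    fix u v assume uv: "a \<le> u \<and> u < v \<and> v \<le> b \<and> set xs \<inter> {u<..<v} = {}"
    \<comment> \<open>The last listed point not beyond \<open>u\<close>. No listed point lies
      strictly between \<open>u\<close> and \<open>v\<close>, so the piece starting there reaches
      \<open>v\<close>.\<close>
    define i where "i = Max {i. i < length xs \<and> xs ! i \<le> u}"
    have "0 \<in> {i. i < length xs \<and> xs ! i \<le> u}" using uv ab xs(1) by auto
    then have "i \<in> {i. i < length xs \<and> xs ! i \<le> u}"
      unfolding i_def by (intro Max_in) auto
    then have i: "i < length xs" "xs ! i \<le> u" by auto
    have "i \<noteq> length xs - 1" using i uv ab by auto
    then have Si: "Suc i < length xs" using i by simp
    have "\<not> xs ! Suc i \<le> u"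
    proof
      assume "xs ! Suc i \<le> u"
      then have "Suc i \<le> i" using Si unfolding i_def by (intro Max_ge) auto
      then show False by simp
    qed
    moreover have "xs ! Suc i \<notin> {u<..<v}" using uv Si nth_mem by blast
    ultimately have "v \<le> xs ! Suc i" by auto
    moreover have "i < length xs - 1" using Si by simp
    then obtain m c where "m \<in> S" "\<forall>t \<in> {xs ! i .. xs ! Suc i}. g t = m * t + c"
      using pieces by blast
    ultimately show "\<exists>m\<in>S. \<exists>c. \<forall>t\<in>{u..v}. g t = m * t + c"
      using i by (intro bexI[of _ m] exI[of _ c]) auto
  qed
  moreover have "a < b" using lt[of 0 "length xs - 1"] ab xs(1) by auto
  ultimately show ?thesis using that[of "set xs"] by simp
qed

lemma pw_affine_if_affine_off:
  assumes "finite X" "affine_off S X a b g" "a < b"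
  shows "pw_affine S a b g"
proof -
  \<comment> \<open>Points outside the open interval are dropped and both ends added, so that the
    sorted list starts at \<open>a\<close> and ends at \<open>b\<close>.\<close>
  define Y where "Y = insert a (insert b (X \<inter> {a<..<b}))"
  define xs where "xs = sorted_list_of_set Y"
  have Y: "finite Y" "a \<in> Y" "b \<in> Y" "Y \<subseteq> {a..b}" using assms unfolding Y_def by auto
  then have xs: "set xs = Y" "sorted_wrt (<) xs" "length xs = card Y" unfolding xs_def by auto
  have "card {a, b} \<le> card Y" using Y by (intro card_mono) auto
  then have len: "length xs \<ge> 2" using xs \<open>a < b\<close> by auto
  have lt: "xs ! i < xs ! j" if "i < j" "j < length xs" for i j
    using xs(2) that by (simp add: sorted_wrt_iff_nth_less)
  have le: "xs ! i \<le> xs ! j" if "i \<le> j" "j < length xs" for i j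
    using lt[of i j] that by (cases "i = j") auto
  obtain i where i: "i < length xs" "xs ! i = a" using Y xs by (metis in_set_conv_nth)
  obtain j where j: "j < length xs" "xs ! j = b" using Y xs by (metis in_set_conv_nth)
  have range: "xs ! k \<in> {a..b}" if "k < length xs" for k using that Y xs nth_mem by blast
  have ne: "xs \<noteq> []" using len by auto
  then have "hd xs = a" using i range[of 0] le[of 0 i] by (simp add: hd_conv_nth)
  moreover have "last xs = b"
    using j range[of "length xs - 1"] le[of j "length xs - 1"] ne
    by (simp add: last_conv_nth) linarith
  moreover have "\<exists>m c. m \<in> S \<and> (\<forall>t \<in> {xs ! k .. xs ! Suc k}. g t = m * t + c)"
    if k: "k < length xs - 1" for k
  proof -
    have k': "k < length xs" "Suc k < length xs" using k by auto
    have bounds: "a \<le> xs ! k" "xs ! Suc k \<le> b" using range[OF k'(1)] range[OF k'(2)] by auto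
    have "X \<inter> {xs ! k <..< xs ! Suc k} = {}"
    proof (rule ccontr)
      assume "X \<inter> {xs ! k <..< xs ! Suc k} \<noteq> {}"
      then obtain x where x: "x \<in> X" "xs ! k < x" "x < xs ! Suc k" by auto
      then have "x \<in> Y" unfolding Y_def using bounds by auto
      then obtain l where l: "l < length xs" "xs ! l = x" using xs by (metis in_set_conv_nth)
      have "\<not> l \<le> k" using x l le[of l k] k' by auto
      moreover have "\<not> Suc k \<le> l" using x l le[of "Suc k" l] by auto
      ultimately show False by simp
    qed
    then show ?thesis
      using affine_offE[OF assms(2) bounds(1) lt[OF lessI k'(2)] bounds(2)] by metis
  qed
  ultimately show ?thesis unfolding pw_affine_def using len xs by blast
qed

text \<open>Going up to the first break beyond \<open>t\<close>, or to \<open>b\<close> if there is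
  none, stays within one affine piece.\<close>

lemma pw_affine_right:
  assumes "pw_affine S a b g" "a \<le> t" "t < b"
  obtains v m c where "t < v" "v \<le> b" "m \<in> S" "\<forall>s\<in>{t..v}. g s = m * s + c"
proof -
  obtain X where X: "finite X" "affine_off S X a b g"
    using affine_off_if_pw_affine[OF assms(1)] by blast
  define v where "v = Min (insert b (X \<inter> {t<..}))"
  have v: "v \<in> insert b (X \<inter> {t<..})" unfolding v_def using X by (intro Min_in) auto
  have "\<And>x. x \<in> insert b (X \<inter> {t<..}) \<Longrightarrow> v \<le> x" unfolding v_def using X by (intro Min_le) auto
  then have "v \<le> b" "X \<inter> {t<..<v} = {}" by force+
  moreover have "t < v" using v assms by auto
  ultimately show ?thesis using affine_offE[OF X(2), of t v] assms that by metis
qed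

lemma pw_affine_left:
  assumes "pw_affine S a b g" "a < t" "t \<le> b"
  obtains u m c where "a \<le> u" "u < t" "m \<in> S" "\<forall>s\<in>{u..t}. g s = m * s + c"
proof -
  obtain X where X: "finite X" "affine_off S X a b g"
    using affine_off_if_pw_affine[OF assms(1)] by blast
  define u where "u = Max (insert a (X \<inter> {..<t}))"
  have u: "u \<in> insert a (X \<inter> {..<t})" unfolding u_def using X by (intro Max_in) auto
  have "\<And>x. x \<in> insert a (X \<inter> {..<t}) \<Longrightarrow> x \<le> u" unfolding u_def using X by (intro Max_ge) auto
  then have "a \<le> u" "X \<inter> {u<..<t} = {}" by force+
  moreover have "u < t" using u assms by auto
  ultimately show ?thesis using affine_offE[OF X(2), of u t] assms that by metis
qed

lemma rslope_eqI:
  assumes "(g has_real_derivative m) (at_right t)"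
  shows "rslope g t = m"
  unfolding rslope_def using assms
  by (intro the_equality) (auto intro: has_field_derivative_unique)

lemma lslope_eqI:
  assumes "(g has_real_derivative m) (at_left t)"
  shows "lslope g t = m"
  unfolding lslope_def using assms
  by (intro the_equality) (auto intro: has_field_derivative_unique)

lemma has_right_derivative_affine:
  assumes "u < v" "\<forall>s\<in>{u..v}. g s = m * s + c"
  shows "(g has_real_derivative m) (at_right u)"
proof -
  have "((\<lambda>s. m * s + c) has_real_derivative m) (at_right u)"
    by (auto intro!: derivative_eq_intros)
  moreover have "((\<lambda>s. m * s + c) has_real_derivative m) (at_right u)
      \<longleftrightarrow> (g has_real_derivative m) (at_right u)"
  proof (rule has_field_derivative_cong_eventually)
    show "\<forall>\<^sub>F s in at_right u. m * s + c = g s"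
      using eventually_at_right_real[OF assms(1)] by eventually_elim (use assms(2) in auto)
    show "m * u + c = g u" using assms by simp
  qed
  ultimately show ?thesis by blast
qed

lemma has_left_derivative_affine:
  assumes "u < v" "\<forall>s\<in>{u..v}. g s = m * s + c"
  shows "(g has_real_derivative m) (at_left v)"
proof -
  have "((\<lambda>s. m * s + c) has_real_derivative m) (at_left v)"
    by (auto intro!: derivative_eq_intros)
  moreover have "((\<lambda>s. m * s + c) has_real_derivative m) (at_left v)
      \<longleftrightarrow> (g has_real_derivative m) (at_left v)"
  proof (rule has_field_derivative_cong_eventually)
    show "\<forall>\<^sub>F s in at_left v. m * s + c = g s"
      using eventually_at_left_real[OF assms(1)] by eventually_elim (use assms(2) in auto)
    show "m * v + c = g v" using assms by simp
  qed
  ultimately show ?thesis by blast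
qed

lemmas rslope_affine = rslope_eqI[OF has_right_derivative_affine]
lemmas lslope_affine = lslope_eqI[OF has_left_derivative_affine]

section \<open>Continuity and closure properties of piecewise affine functions\<close>

lemma pw_affine_mono:
  assumes "pw_affine S a b g" "S \<subseteq> T"
  shows "pw_affine T a b g"
proof -
  obtain X where "finite X" "affine_off S X a b g" "a < b"
    using affine_off_if_pw_affine[OF assms(1)] .
  then show ?thesis
    using affine_off_mono[OF _ order_refl assms(2) order_refl order_refl] pw_affine_if_affine_off
    by blast
qed

lemma pw_affine_continuous_on:
  assumes "pw_affine S a b g"
  shows "continuous_on {a..b} g"
proof -
  obtain X where X: "finite X" "affine_off S X a b g" "a < b"
    using affine_off_if_pw_affine[OF assms] .
  from X(1,3) show ?thesis
  proof (induction rule: finite_subdivision_induct)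
    case (gap u v)
    then obtain m c where "\<forall>t\<in>{u..v}. g t = m * t + c"
      using affine_offE[OF X(2)] by metis
    then have "continuous_on {u..v} g \<longleftrightarrow> continuous_on {u..v} (\<lambda>t. m * t + c)"
      by (intro continuous_on_cong) auto
    then show ?case by (auto intro!: continuous_intros)
  next
    case (join u c v)
    then have "{u..v} = {u..c} \<union> {c..v}" by auto
    then show ?case using join by (simp add: continuous_on_closed_Un)
  qed
qed

lemma pw_affine_linear:
  assumes "a < b" "m \<in> S" "\<forall>t\<in>{a..b}. g t = m * t + c"
  shows "pw_affine S a b g"
proof (rule pw_affine_if_affine_off[of "{}"])
  show "affine_off S {} a b g"
    unfolding affine_off_def
  proof (intro allI impI)
    fix u v assume "a \<le> u \<and> u < v \<and> v \<le> b \<and> {} \<inter> {u<..<v} = {}"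
    then show "\<exists>m\<in>S. \<exists>c. \<forall>t\<in>{u..v}. g t = m * t + c"
      using assms by (intro bexI[of _ m] exI[of _ c]) auto
  qed
qed (use assms in auto)

lemma pw_affine_join:
  assumes "pw_affine S a c g" "pw_affine S c b g"
  shows "pw_affine S a b g"
proof -
  obtain X where X: "finite X" "affine_off S X a c g" "a < c"
    using affine_off_if_pw_affine[OF assms(1)] .
  obtain Y where Y: "finite Y" "affine_off S Y c b g" "c < b"
    using affine_off_if_pw_affine[OF assms(2)] .
  have "affine_off S (insert c (X \<union> Y)) a b g"
    unfolding affine_off_def
  proof (intro allI impI)
    fix u v assume uv: "a \<le> u \<and> u < v \<and> v \<le> b \<and> insert c (X \<union> Y) \<inter> {u<..<v} = {}"
    then have "v \<le> c \<or> c \<le> u" by auto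
    then show "\<exists>m\<in>S. \<exists>c. \<forall>t\<in>{u..v}. g t = m * t + c"
    proof
      assume "v \<le> c"
      then show ?thesis using uv X(2) unfolding affine_off_def by blast
    next
      assume "c \<le> u"
      then show ?thesis using uv Y(2) unfolding affine_off_def by blast
    qed
  qed
  then show ?thesis using X Y by (intro pw_affine_if_affine_off[of "insert c (X \<union> Y)"]) auto
qed

lemma pw_affine_add:
  assumes "pw_affine UNIV a b g" "pw_affine UNIV a b h"
  shows "pw_affine UNIV a b (\<lambda>t. g t + h t)"
proof -
  obtain X where X: "finite X" "affine_off UNIV X a b g" "a < b"
    using affine_off_if_pw_affine[OF assms(1)] .
  obtain Y where Y: "finite Y" "affine_off UNIV Y a b h" "a < b"
    using affine_off_if_pw_affine[OF assms(2)] .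
  have "affine_off UNIV (X \<union> Y) a b (\<lambda>t. g t + h t)"
    unfolding affine_off_def
  proof (intro allI impI)
    fix u v assume uv: "a \<le> u \<and> u < v \<and> v \<le> b \<and> (X \<union> Y) \<inter> {u<..<v} = {}"
    then have uv': "a \<le> u" "u < v" "v \<le> b" "X \<inter> {u<..<v} = {}" "Y \<inter> {u<..<v} = {}" by auto
    obtain m c where m: "m \<in> UNIV" "\<forall>t\<in>{u..v}. g t = m * t + c"
      using affine_offE[OF X(2) uv'(1-4)] by blast
    obtain n d where n: "n \<in> UNIV" "\<forall>t\<in>{u..v}. h t = n * t + d"
      using affine_offE[OF Y(2) uv'(1-3,5)] by blast
    show "\<exists>m\<in>UNIV. \<exists>c. \<forall>t\<in>{u..v}. g t + h t = m * t + c"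
      by (intro bexI[of _ "m + n"] exI[of _ "c + d"]) (auto simp: m n algebra_simps)
  qed
  then show ?thesis using X Y by (intro pw_affine_if_affine_off[of "X \<union> Y"]) auto
qed

lemma pw_affine_cmult:
  assumes "pw_affine UNIV a b g"
  shows "pw_affine UNIV a b (\<lambda>t. k * g t)"
proof -
  obtain X where X: "finite X" "affine_off UNIV X a b g" "a < b"
    using affine_off_if_pw_affine[OF assms(1)] .
  have "affine_off UNIV X a b (\<lambda>t. k * g t)"
    unfolding affine_off_def
  proof (intro allI impI)
    fix u v assume uv: "a \<le> u \<and> u < v \<and> v \<le> b \<and> X \<inter> {u<..<v} = {}"
    then have uv': "a \<le> u" "u < v" "v \<le> b" "X \<inter> {u<..<v} = {}" by auto
    obtain m c where m: "m \<in> UNIV" "\<forall>t\<in>{u..v}. g t = m * t + c"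
      using affine_offE[OF X(2) uv'(1-4)] by blast
    show "\<exists>m\<in>UNIV. \<exists>c. \<forall>t\<in>{u..v}. k * g t = m * t + c"
      by (intro bexI[of _ "k * m"] exI[of _ "k * c"]) (auto simp: m algebra_simps)
  qed
  then show ?thesis using X by (intro pw_affine_if_affine_off[of "X"]) auto
qed

lemma pw_affine_min_const_linear:
  assumes "a < b" "m \<in> S" "0 \<in> S" and g: "\<forall>t\<in>{a..b}. g t = m * t + c"
  shows "pw_affine S a b (\<lambda>t. min (g t) k)"
proof (cases "m = 0")
  case True
  then show ?thesis using assms by (intro pw_affine_linear[of _ _ 0 _ _ "min c k"]) auto
next
  case False
  \<comment> \<open>The height \<open>k\<close> is attained only at \<open>z\<close>, so one break
    suffices. The truncated side has slope 0, whence \<open>0 \<in> S\<close>.\<close>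
  define z where "z = (k - c) / m"
  have z: "m * t + c \<le> k \<longleftrightarrow> (if 0 < m then t \<le> z else z \<le> t)" for t
    using False unfolding z_def by (auto simp: field_simps)
  have "affine_off S {z} a b (\<lambda>t. min (g t) k)"
    unfolding affine_off_def
  proof (intro allI impI)
    fix u v assume uv: "a \<le> u \<and> u < v \<and> v \<le> b \<and> {z} \<inter> {u<..<v} = {}"
    then have side: "v \<le> z \<or> z \<le> u" by auto
    have "(\<forall>t\<in>{u..v}. g t \<le> k) \<or> (\<forall>t\<in>{u..v}. k \<le> g t)"
    proof -
      have z': "k \<le> m * t + c \<longleftrightarrow> (if 0 < m then z \<le> t else t \<le> z)" for t
        using False unfolding z_def by (auto simp: field_simps)
      have gt: "g t = m * t + c" if "t \<in> {u..v}" for t using g uv that by auto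
      show ?thesis
      \<comment> \<open>A rising line is below \<open>k\<close> left of \<open>z\<close>, a falling
        one right of \<open>z\<close>; the equality of truth values covers both.\<close>
      proof (cases "(v \<le> z) = (0 < m)")
        case True
        then have "g t \<le> k" if "t \<in> {u..v}" for t
          using side that z[of t] gt[OF that] by (auto split: if_splits)
        then show ?thesis by blast
      next
        case False
        then have "k \<le> g t" if "t \<in> {u..v}" for t
          using side that z'[of t] gt[OF that] by (auto split: if_splits)
        then show ?thesis by blast
      qed
    qed
    then show "\<exists>m\<in>S. \<exists>c. \<forall>t\<in>{u..v}. min (g t) k = m * t + c"
    proof
      assume "\<forall>t\<in>{u..v}. g t \<le> k"
      then show ?thesis using g uv assms by (intro bexI[of _ m] exI[of _ c]) (auto simp: min_def)
    next
      assume "\<forall>t\<in>{u..v}. k \<le> g t"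
      then show ?thesis using assms by (intro bexI[of _ 0] exI[of _ k]) (auto simp: min_def)
    qed
  qed
  then show ?thesis using \<open>a < b\<close> by (intro pw_affine_if_affine_off[of "{z}"]) auto
qed

lemma pw_affine_min_const:
  assumes "pw_affine S a b g" "0 \<in> S"
  shows "pw_affine S a b (\<lambda>t. min (g t) k)"
proof -
  obtain X where X: "finite X" "affine_off S X a b g" "a < b"
    using affine_off_if_pw_affine[OF assms(1)] .
  from X(1,3) show ?thesis
  proof (induction rule: finite_subdivision_induct)
    case (gap u v)
    then obtain m c where "m \<in> S" "\<forall>t\<in>{u..v}. g t = m * t + c"
      using affine_offE[OF X(2)] by metis
    then show ?case using gap assms pw_affine_min_const_linear by blast
  next
    case (join u c v)
    then show ?case using pw_affine_join by blast
  qed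
qed

section \<open>One-sided slopes and their comparison\<close>

lemma has_right_derivative_rslope:
  assumes "pw_affine S a b g" "a \<le> t" "t < b"
  shows "(g has_real_derivative rslope g t) (at_right t)" "rslope g t \<in> S"
proof -
  obtain v m c where *: "t < v" "v \<le> b" "m \<in> S" "\<forall>s\<in>{t..v}. g s = m * s + c"
    using pw_affine_right[OF assms] .
  then have "rslope g t = m" using rslope_affine[OF *(1) *(4)] by simp
  then show "(g has_real_derivative rslope g t) (at_right t)" "rslope g t \<in> S"
    using * has_right_derivative_affine[OF *(1) *(4)] by simp_all
qed

lemma has_left_derivative_lslope:
  assumes "pw_affine S a b g" "a < t" "t \<le> b"
  shows "(g has_real_derivative lslope g t) (at_left t)" "lslope g t \<in> S"
proof -
  obtain u m c where *: "a \<le> u" "u < t" "m \<in> S" "\<forall>s\<in>{u..t}. g s = m * s + c"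
    using pw_affine_left[OF assms] .
  then have "lslope g t = m" using lslope_affine[OF *(2) *(4)] by simp
  then show "(g has_real_derivative lslope g t) (at_left t)" "lslope g t \<in> S"
    using * has_left_derivative_affine[OF *(2) *(4)] by simp_all
qed

text \<open>Just right of \<open>t\<close> both functions are affine, so comparing their values at
  one common point \<open>s\<close> compares the slopes. With its left-hand analogue this yields a
  comparison principle for the Laplacian.\<close>

lemma rslope_mono:
  assumes "pw_affine S a b g" "pw_affine T a b h" "a \<le> t" "t < b"
    and le: "\<And>s. s \<in> {a..b} \<Longrightarrow> g s \<le> h s" and eq: "g t = h t"
  shows "rslope g t \<le> rslope h t"
proof -
  obtain v m c where g: "t < v" "v \<le> b" "\<forall>s\<in>{t..v}. g s = m * s + c"
    using pw_affine_right[OF assms(1,3,4)] by metis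
  obtain w n d where h: "t < w" "w \<le> b" "\<forall>s\<in>{t..w}. h s = n * s + d"
    using pw_affine_right[OF assms(2,3,4)] by metis
  define s where "s = min v w"
  have s: "t < s" "s \<in> {t..v}" "s \<in> {t..w}" "s \<in> {a..b}" using g h assms(3) unfolding s_def by auto
  have "m * (s - t) \<le> n * (s - t)"
  proof -
    have "g s = m * s + c" "g t = m * t + c" "h s = n * s + d" "h t = n * t + d"
      using g h s by auto
    then show ?thesis using le[OF s(4)] eq unfolding right_diff_distrib by linarith
  qed
  then have "m \<le> n" using s(1) by simp
  moreover have "rslope g t = m" "rslope h t = n"
    using rslope_affine[OF g(1,3)] rslope_affine[OF h(1,3)] by simp_all
  ultimately show ?thesis by simp
qed

lemma lslope_antimono:
  assumes "pw_affine S a b g" "pw_affine T a b h" "a < t" "t \<le> b"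
    and le: "\<And>s. s \<in> {a..b} \<Longrightarrow> g s \<le> h s" and eq: "g t = h t"
  shows "lslope h t \<le> lslope g t"
proof -
  obtain v m c where g: "a \<le> v" "v < t" "\<forall>s\<in>{v..t}. g s = m * s + c"
    using pw_affine_left[OF assms(1,3,4)] by metis
  obtain w n d where h: "a \<le> w" "w < t" "\<forall>s\<in>{w..t}. h s = n * s + d"
    using pw_affine_left[OF assms(2,3,4)] by metis
  define s where "s = max v w"
  have s: "s < t" "s \<in> {v..t}" "s \<in> {w..t}" "s \<in> {a..b}" using g h assms(4) unfolding s_def by auto
  have "n * (t - s) \<le> m * (t - s)"
  proof -
    have "g s = m * s + c" "g t = m * t + c" "h s = n * s + d" "h t = n * t + d"
      using g h s by auto
    then show ?thesis using le[OF s(4)] eq unfolding right_diff_distrib by linarith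
  qed
  then have "n \<le> m" using s(1) by simp
  moreover have "lslope g t = m" "lslope h t = n"
    using lslope_affine[OF g(2,3)] lslope_affine[OF h(2,3)] by simp_all
  ultimately show ?thesis by simp
qed

text \<open>One affine piece surrounds a point that is no break. Hence the Laplacian inside an edge
  is supported on the break set.\<close>

lemma lslope_eq_rslope_off:
  assumes "affine_off S X a b g" "finite X" "a < t" "t < b" "t \<notin> X"
  shows "lslope g t = rslope g t"
proof -
  define u where "u = Max (insert a (X \<inter> {..<t}))"
  define v where "v = Min (insert b (X \<inter> {t<..}))"
  have v: "v \<in> insert b (X \<inter> {t<..})" unfolding v_def using assms by (intro Min_in) auto
  have v': "\<And>x. x \<in> insert b (X \<inter> {t<..}) \<Longrightarrow> v \<le> x" unfolding v_def using assms by (intro Min_le) auto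
  have u: "u \<in> insert a (X \<inter> {..<t})" unfolding u_def using assms by (intro Max_in) auto
  have u': "\<And>x. x \<in> insert a (X \<inter> {..<t}) \<Longrightarrow> x \<le> u" unfolding u_def using assms by (intro Max_ge) auto
  have uv: "a \<le> u" "u < t" "t < v" "v \<le> b" using u v u' v' assms by auto
  have "X \<inter> {u<..<v} = {}"
  proof (rule ccontr)
    assume "X \<inter> {u<..<v} \<noteq> {}"
    then obtain x where "x \<in> X" "u < x" "x < v" by auto
    moreover then have "x \<noteq> t" using assms by auto
    ultimately show False using u'[of x] v'[of x] by (cases "x < t") auto
  qed
  then obtain m c where g: "\<forall>s\<in>{u..v}. g s = m * s + c"
    using affine_offE[OF assms(1) uv(1) less_trans[OF uv(2,3)] uv(4)] by metis
  then have "rslope g t = m" using uv by (intro rslope_affine[of t v _ _ c]) auto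
  moreover have "lslope g t = m" using uv g by (intro lslope_affine[of u t _ _ c]) auto
  ultimately show ?thesis by simp
qed

text \<open>Integrating by parts, this is the integral of the product of the derivatives of
  \<^term>\<open>f\<close> and \<^term>\<open>g\<close> over \<^term>\<open>{a..b}\<close>.\<close>

definition edge_form :: "real set \<Rightarrow> real \<Rightarrow> real \<Rightarrow> (real \<Rightarrow> real) \<Rightarrow> (real \<Rightarrow> real) \<Rightarrow> real" where
  "edge_form X a b f g =
     f b * lslope g b - f a * rslope g a + (\<Sum>t\<in>X \<inter> {a<..<b}. f t * (lslope g t - rslope g t))"

text \<open>The left slope at \<open>c\<close> comes from the first half and the right slope from
  the second; together they form the summand at \<open>c\<close>, which the whole sum contains
  because \<open>c \<in> X\<close>.\<close>

lemma edge_form_join: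
  assumes "finite X" "a < c" "c < b" "c \<in> X"
  shows "edge_form X a b f g = edge_form X a c f g + edge_form X c b f g"
proof -
  have "X \<inter> {a<..<b} = insert c (X \<inter> {a<..<c} \<union> X \<inter> {c<..<b})" using assms by auto
  moreover have "(\<Sum>t\<in>insert c (X \<inter> {a<..<c} \<union> X \<inter> {c<..<b}). f t * (lslope g t - rslope g t))
    = f c * (lslope g c - rslope g c) + ((\<Sum>t\<in>X \<inter> {a<..<c}. f t * (lslope g t - rslope g t))
      + (\<Sum>t\<in>X \<inter> {c<..<b}. f t * (lslope g t - rslope g t)))"
    using assms by (subst sum.insert; (subst sum.union_disjoint)?) auto
  ultimately show ?thesis unfolding edge_form_def by (simp add: algebra_simps)
qed

lemma edge_form_linear:
  assumes "a < b" "X \<inter> {a<..<b} = {}" "\<forall>t\<in>{a..b}. g t = m * t + c"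
  shows "edge_form X a b f g = m * (f b - f a)"
proof -
  have "rslope g a = m" "lslope g b = m"
    using rslope_affine[OF assms(1,3)] lslope_affine[OF assms(1,3)] by simp_all
  then show ?thesis unfolding edge_form_def using assms by (simp add: algebra_simps)
qed

text \<open>On a piece where the functions have slopes \<open>m\<close> and \<open>n\<close>, both
  sides are \<open>m * n * (v - u)\<close>.\<close>

lemma edge_form_sym:
  assumes "finite X" "a < b" "affine_off UNIV X a b f" "affine_off UNIV X a b g"
  shows "edge_form X a b f g = edge_form X a b g f"
  using assms(1,2)
proof (induction rule: finite_subdivision_induct)
  case (gap u v)
  obtain m c where f: "\<forall>t\<in>{u..v}. f t = m * t + c"
    using affine_offE[OF assms(3) gap] by metis
  obtain n d where g: "\<forall>t\<in>{u..v}. g t = n * t + d"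
    using affine_offE[OF assms(4) gap] by metis
  have "edge_form X u v f g = n * (f v - f u)" "edge_form X u v g f = m * (g v - g u)"
    using edge_form_linear[OF gap(2,4) g] edge_form_linear[OF gap(2,4) f] by simp_all
  moreover have "f u = m * u + c" "f v = m * v + c" "g u = n * u + d" "g v = n * v + d"
    using f g gap(2) by auto
  ultimately show ?case by (simp add: algebra_simps)
next
  case (join u c v)
  then show ?case using edge_form_join[OF assms(1)] by simp
qed

text \<open>Each piece contributes \<open>m^2 * (v - u)\<close>. The sum vanishes only if every
  slope does, and the pieces share their joints, so the constants agree.\<close>

lemma edge_form_self:
  assumes "finite X" "a < b" "affine_off UNIV X a b g"
  shows "edge_form X a b g g \<ge> 0 \<and> (edge_form X a b g g = 0 \<longrightarrow> (\<forall>t\<in>{a..b}. g t = g a))"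
  using assms(1,2)
proof (induction rule: finite_subdivision_induct)
  case (gap u v)
  obtain m c where g: "\<forall>t\<in>{u..v}. g t = m * t + c"
    using affine_offE[OF assms(3) gap] by metis
  have "edge_form X u v g g = m * (g v - g u)"
    using edge_form_linear[OF gap(2,4) g] by simp
  also have "\<dots> = m^2 * (v - u)"
    using g gap(2) by (simp add: algebra_simps power2_eq_square)
  finally have "edge_form X u v g g = m^2 * (v - u)" .
  moreover have "\<forall>t\<in>{u..v}. g t = g u" if "m = 0"
    using that g gap(2) by simp
  moreover have "m^2 * (v - u) = 0 \<longleftrightarrow> m = 0" "0 \<le> m^2 * (v - u)" using gap(2) by simp_all
  ultimately show ?case by metis
next
  case (join u c v)
  have "edge_form X u v g g = edge_form X u c g g + edge_form X c v g g"
    using edge_form_join[OF assms(1) join(2,3,5)] .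
  moreover have "\<forall>t\<in>{u..v}. g t = g u"
    if *: "edge_form X u c g g = 0" "edge_form X c v g g = 0"
  proof
    fix t assume t: "t \<in> {u..v}"
    have "\<forall>t\<in>{u..c}. g t = g u" "\<forall>t\<in>{c..v}. g t = g c" using join * by blast+
    moreover have "c \<in> {u..c}" "t \<in> {u..c} \<or> t \<in> {c..v}" using t join(2,3) by auto
    ultimately show "g t = g u" by metis
  qed
  ultimately show ?case using join.IH by (metis add_nonneg_eq_0_iff add_nonneg_nonneg)
qed

section \<open>The Laplacian on a metric graph\<close>

lemma metric_graphD:
  assumes "metric_graph G"
  shows "finite (verts G)" "finite (edges G)" "verts G \<noteq> {}"
    and "e \<in> edges G \<Longrightarrow> src G e \<in> verts G" "e \<in> edges G \<Longrightarrow> tgt G e \<in> verts G"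
    and "e \<in> edges G \<Longrightarrow> 0 < len G e"
  using assms unfolding metric_graph_def by auto

lemma metric_graph_connected:
  assumes "metric_graph G" "S \<subseteq> verts G" "S \<noteq> {}"
    and "\<And>e. e \<in> edges G \<Longrightarrow> src G e \<in> S \<longleftrightarrow> tgt G e \<in> S"
  shows "S = verts G"
  using assms unfolding metric_graph_def by blast

lemma pos_in_pts:
  assumes "metric_graph G" "e \<in> edges G"
  shows "pos G e t \<in> pts G"
  using metric_graphD[OF assms(1)] assms(2) unfolding pos_def pts_def by auto

lemma edge_fun_simps:
  shows "edge_fun G f e 0 = f (Vert (src G e))"
    and "0 < len G e \<Longrightarrow> edge_fun G f e (len G e) = f (Vert (tgt G e))"
    and "0 < t \<Longrightarrow> t < len G e \<Longrightarrow> edge_fun G f e t = f (EdgePt e t)"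
  unfolding edge_fun_def pos_def by auto

lemma edge_fun_cong:
  assumes "metric_graph G" "e \<in> edges G" "\<And>p. p \<in> pts G \<Longrightarrow> f p = g p"
  shows "edge_fun G f e = edge_fun G g e"
  unfolding edge_fun_def using pos_in_pts[OF assms(1,2)] assms(3) by auto

lemma pts_cases:
  assumes "p \<in> pts G"
  obtains v where "v \<in> verts G" "p = Vert v"
  | e t where "e \<in> edges G" "0 < t" "t < len G e" "p = EdgePt e t"
  using assms unfolding pts_def by auto

lemma cpaD: "cpa G f \<Longrightarrow> e \<in> edges G \<Longrightarrow> pw_affine UNIV 0 (len G e) (edge_fun G f e)"
  unfolding cpa_def by blast

lemma rational_fun_imp_cpa: "rational_fun G f \<Longrightarrow> cpa G f"
  unfolding cpa_def rational_fun_def using pw_affine_mono[OF _ subset_UNIV] by blast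

lemma cpa_cong:
  assumes "metric_graph G" "\<And>p. p \<in> pts G \<Longrightarrow> f p = g p"
  shows "cpa G f \<longleftrightarrow> cpa G g"
  using edge_fun_cong[OF assms(1) _ assms(2)] unfolding cpa_def by auto

lemma lap_Vert:
  "v \<in> verts G \<Longrightarrow> lap G f (Vert v) =
     (\<Sum>e\<in>{e \<in> edges G. tgt G e = v}. lslope (edge_fun G f e) (len G e))
     - (\<Sum>e\<in>{e \<in> edges G. src G e = v}. rslope (edge_fun G f e) 0)"
  unfolding lap_def out_slopes_def pts_def by (simp add: sum_negf)

lemma lap_EdgePt:
  "e \<in> edges G \<Longrightarrow> 0 < t \<Longrightarrow> t < len G e \<Longrightarrow>
     lap G f (EdgePt e t) = lslope (edge_fun G f e) t - rslope (edge_fun G f e) t"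
  unfolding lap_def out_slopes_def pts_def by simp

lemma lap_outside: "p \<notin> pts G \<Longrightarrow> lap G f p = 0"
  unfolding lap_def by simp

lemma lap_cong:
  assumes "metric_graph G" "\<And>p. p \<in> pts G \<Longrightarrow> f p = g p"
  shows "lap G f p = lap G g p"
proof (cases "p \<in> pts G")
  case True
  then show ?thesis
  proof (cases rule: pts_cases)
    case (1 v)
    then show ?thesis using edge_fun_cong[OF assms(1) _ assms(2)] by (simp add: lap_Vert)
  next
    case (2 e t)
    then show ?thesis using edge_fun_cong[OF assms(1) _ assms(2)] by (simp add: lap_EdgePt)
  qed
qed (simp add: lap_outside)

text \<open>\<open>lap\<close> is minus the sum of outgoing slopes. The upper function leaves the
  contact point with the larger slopes, so it has the smaller Laplacian there.\<close>

lemma lap_antimono: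
  assumes G: "metric_graph G" and f: "cpa G f" and h: "cpa G h"
    and le: "\<And>x. x \<in> pts G \<Longrightarrow> f x \<le> h x" and p: "p \<in> pts G" "f p = h p"
  shows "lap G h p \<le> lap G f p"
proof -
  have le': "edge_fun G f e t \<le> edge_fun G h e t" if "e \<in> edges G" for e t
    using le pos_in_pts[OF G that] unfolding edge_fun_def by blast
  have r: "rslope (edge_fun G f e) t \<le> rslope (edge_fun G h e) t"
    if "e \<in> edges G" "0 \<le> t" "t < len G e" "edge_fun G f e t = edge_fun G h e t" for e t
    using rslope_mono[OF cpaD[OF f] cpaD[OF h]] that le' by blast
  have l: "lslope (edge_fun G h e) t \<le> lslope (edge_fun G f e) t"
    if "e \<in> edges G" "0 < t" "t \<le> len G e" "edge_fun G f e t = edge_fun G h e t" for e t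
    using lslope_antimono[OF cpaD[OF f] cpaD[OF h]] that le' by blast
  show ?thesis using p(1)
  proof (cases rule: pts_cases)
    case (1 v)
    have "(\<Sum>e\<in>{e \<in> edges G. tgt G e = v}. lslope (edge_fun G h e) (len G e))
        \<le> (\<Sum>e\<in>{e \<in> edges G. tgt G e = v}. lslope (edge_fun G f e) (len G e))"
      using metric_graphD(6)[OF G] p(2) 1 by (intro sum_mono l) (auto simp: edge_fun_simps less_imp_le)
    moreover have "(\<Sum>e\<in>{e \<in> edges G. src G e = v}. rslope (edge_fun G f e) 0)
        \<le> (\<Sum>e\<in>{e \<in> edges G. src G e = v}. rslope (edge_fun G h e) 0)"
      using metric_graphD(6)[OF G] p(2) 1 by (intro sum_mono r) (auto simp: edge_fun_simps)
    ultimately show ?thesis using 1 by (simp add: lap_Vert)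
  next
    case (2 e t)
    then have "edge_fun G f e t = edge_fun G h e t" using p by (simp add: edge_fun_simps)
    then show ?thesis using r[of e t] l[of e t] 2 by (simp add: lap_EdgePt)
  qed
qed

section \<open>Linearity and integrality of the Laplacian\<close>

lemma cpa_add:
  assumes "cpa G f" "cpa G h"
  shows "cpa G (\<lambda>p. f p + h p)"
  using pw_affine_add[OF cpaD[OF assms(1)] cpaD[OF assms(2)]] unfolding cpa_def edge_fun_def by blast

lemma cpa_cmult:
  assumes "cpa G f"
  shows "cpa G (\<lambda>p. k * f p)"
  using pw_affine_cmult[OF cpaD[OF assms(1)]] unfolding cpa_def edge_fun_def by blast

lemma cpa_const:
  assumes "metric_graph G"
  shows "cpa G (\<lambda>p. k)"
  unfolding cpa_def edge_fun_def
  using metric_graphD(6)[OF assms] by (intro ballI pw_affine_linear[of _ _ 0 _ _ k]) auto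

lemma lap_add:
  assumes G: "metric_graph G" and f: "cpa G f" and h: "cpa G h"
  shows "lap G (\<lambda>p. f p + h p) p = lap G f p + lap G h p"
proof (cases "p \<in> pts G")
  case True
  have eq: "edge_fun G (\<lambda>p. f p + h p) e = (\<lambda>t. edge_fun G f e t + edge_fun G h e t)" for e
    unfolding edge_fun_def by simp
  have r: "rslope (edge_fun G (\<lambda>p. f p + h p) e) t = rslope (edge_fun G f e) t + rslope (edge_fun G h e) t"
    if "e \<in> edges G" "0 \<le> t" "t < len G e" for e t
    unfolding eq using that has_right_derivative_rslope(1)[OF cpaD[OF f]]
      has_right_derivative_rslope(1)[OF cpaD[OF h]] by (intro rslope_eqI DERIV_add) blast+
  have l: "lslope (edge_fun G (\<lambda>p. f p + h p) e) t = lslope (edge_fun G f e) t + lslope (edge_fun G h e) t"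
    if "e \<in> edges G" "0 < t" "t \<le> len G e" for e t
    unfolding eq using that has_left_derivative_lslope(1)[OF cpaD[OF f]]
      has_left_derivative_lslope(1)[OF cpaD[OF h]] by (intro lslope_eqI DERIV_add) blast+
  from True show ?thesis
  proof (cases rule: pts_cases)
    case (1 v)
    then show ?thesis using metric_graphD(6)[OF G] by (simp add: lap_Vert r l sum.distrib less_imp_le)
  next
    case (2 e t)
    then show ?thesis by (simp add: lap_EdgePt r l)
  qed
qed (simp add: lap_outside)

lemma lap_cmult:
  assumes G: "metric_graph G" and f: "cpa G f"
  shows "lap G (\<lambda>p. k * f p) p = k * lap G f p"
proof (cases "p \<in> pts G")
  case True
  have eq: "edge_fun G (\<lambda>p. k * f p) e = (\<lambda>t. k * edge_fun G f e t)" for e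
    unfolding edge_fun_def by simp
  have r: "rslope (edge_fun G (\<lambda>p. k * f p) e) t = k * rslope (edge_fun G f e) t"
    if "e \<in> edges G" "0 \<le> t" "t < len G e" for e t
    unfolding eq using that has_right_derivative_rslope(1)[OF cpaD[OF f]]
    by (intro rslope_eqI DERIV_cmult) blast+
  have l: "lslope (edge_fun G (\<lambda>p. k * f p) e) t = k * lslope (edge_fun G f e) t"
    if "e \<in> edges G" "0 < t" "t \<le> len G e" for e t
    unfolding eq using that has_left_derivative_lslope(1)[OF cpaD[OF f]]
    by (intro lslope_eqI DERIV_cmult) blast+
  from True show ?thesis
  proof (cases rule: pts_cases)
    case (1 v)
    then show ?thesis using metric_graphD(6)[OF G]
      by (simp add: lap_Vert r l sum_distrib_left right_diff_distrib less_imp_le)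
  next
    case (2 e t)
    then show ?thesis by (simp add: lap_EdgePt r l right_diff_distrib)
  qed
qed (simp add: lap_outside)

lemma lap_const: "lap G (\<lambda>p. k) p = 0"
proof -
  have "rslope (edge_fun G (\<lambda>p. k) e) t = 0" "lslope (edge_fun G (\<lambda>p. k) e) t = 0" for e t
    unfolding edge_fun_def by (auto intro!: rslope_eqI lslope_eqI)
  then show ?thesis by (cases p) (simp_all add: lap_def out_slopes_def)
qed

lemma lap_rational_Ints:
  assumes G: "metric_graph G" and f: "rational_fun G f"
  shows "lap G f p \<in> \<int>"
proof (cases "p \<in> pts G")
  case True
  have pw: "pw_affine \<int> 0 (len G e) (edge_fun G f e)" if "e \<in> edges G" for e
    using f that unfolding rational_fun_def by blast
  from True show ?thesis
  proof (cases rule: pts_cases)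
    case (1 v)
    then show ?thesis using metric_graphD(6)[OF G]
      by (auto simp: lap_Vert less_imp_le intro!: Ints_diff Ints_sum
          has_right_derivative_rslope(2)[OF pw] has_left_derivative_lslope(2)[OF pw])
  next
    case (2 e t)
    then show ?thesis
      by (auto simp: lap_EdgePt intro!: Ints_diff
          has_right_derivative_rslope(2)[OF pw] has_left_derivative_lslope(2)[OF pw])
  qed
qed (simp add: lap_outside)

section \<open>Summation by parts and the Dirichlet energy\<close>

lemma cpa_breaks:
  assumes "cpa G f" "cpa G g"
  obtains X where "\<And>e. e \<in> edges G \<Longrightarrow> finite (X e)"
    and "\<And>e. e \<in> edges G \<Longrightarrow> affine_off UNIV (X e) 0 (len G e) (edge_fun G f e)"
    and "\<And>e. e \<in> edges G \<Longrightarrow> affine_off UNIV (X e) 0 (len G e) (edge_fun G g e)"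
proof -
  have "\<exists>X. finite X \<and> affine_off UNIV X 0 (len G e) (edge_fun G f e) \<and>
      affine_off UNIV X 0 (len G e) (edge_fun G g e)" if e: "e \<in> edges G" for e
  proof -
    obtain X where X: "finite X" "affine_off UNIV X 0 (len G e) (edge_fun G f e)" "0 < len G e"
      using affine_off_if_pw_affine[OF cpaD[OF assms(1) e]] .
    obtain Y where Y: "finite Y" "affine_off UNIV Y 0 (len G e) (edge_fun G g e)" "0 < len G e"
      using affine_off_if_pw_affine[OF cpaD[OF assms(2) e]] .
    show ?thesis
      using X Y affine_off_mono[OF X(2), of "X \<union> Y"] affine_off_mono[OF Y(2), of "X \<union> Y"]
      by (intro exI[of _ "X \<union> Y"]) auto
  qed
  then have "\<forall>e\<in>edges G. \<exists>X. finite X \<and> affine_off UNIV X 0 (len G e) (edge_fun G f e) \<and>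
      affine_off UNIV X 0 (len G e) (edge_fun G g e)" by blast
  from bchoice[OF this] show ?thesis using that by blast
qed

text \<open>Discrete integration by parts. A vertex term is a sum over the edge ends at that vertex,
  so regrouping by edges gives the boundary terms of \<open>edge_form\<close>; breaks inside an edge
  give its inner sum. A loop counts once as source and once as target.\<close>

lemma sum_lap_eq_edge_form:
  assumes G: "metric_graph G"
    and X: "\<And>e. e \<in> edges G \<Longrightarrow> finite (X e)"
    and g: "\<And>e. e \<in> edges G \<Longrightarrow> affine_off UNIV (X e) 0 (len G e) (edge_fun G g e)"
  shows "finite {p. lap G g p \<noteq> 0}"
    and "(\<Sum>p | lap G g p \<noteq> 0. f p * lap G g p) =
      (\<Sum>e\<in>edges G. edge_form (X e) 0 (len G e) (edge_fun G f e) (edge_fun G g e))"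
proof -
  note fin = metric_graphD(1,2)[OF G]
  define I where "I = (SIGMA e:edges G. X e \<inter> {0<..<len G e})"
  \<comment> \<open>A finite set containing the support, on which the sum splits into vertices and
    break points.\<close>
  define A where "A = Vert ` verts G \<union> (\<lambda>(e, t). EdgePt e t) ` I"
  define h where "h p = f p * lap G g p" for p
  have "finite I" unfolding I_def using fin X by auto
  then have A: "finite A" unfolding A_def using fin by auto
  have supp: "{p. lap G g p \<noteq> 0} \<subseteq> A"
  proof
    fix p assume p: "p \<in> {p. lap G g p \<noteq> 0}"
    then have "p \<in> pts G" using lap_outside by blast
    then show "p \<in> A"
    proof (cases rule: pts_cases)
      case (1 v)
      then show ?thesis unfolding A_def by auto
    next
      case (2 e t)
      have "t \<in> X e"
      proof (rule ccontr)
        assume "t \<notin> X e"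
        then show False using lslope_eq_rslope_off[OF g X] 2 p by (simp add: lap_EdgePt)
      qed
      then show ?thesis unfolding A_def I_def using 2 by force
    qed
  qed
  then show "finite {p. lap G g p \<noteq> 0}" using A finite_subset by blast
  have "(\<Sum>p | lap G g p \<noteq> 0. h p) = sum h A"
    using A supp unfolding h_def by (intro sum.mono_neutral_left) auto
  also have "\<dots> = sum h (Vert ` verts G) + sum h ((\<lambda>(e, t). EdgePt e t) ` I)"
    unfolding A_def using fin \<open>finite I\<close> by (intro sum.union_disjoint) auto
  also have "sum h (Vert ` verts G) = (\<Sum>v\<in>verts G. h (Vert v))"
    by (subst sum.reindex) (auto simp: inj_on_def)
  also have "\<dots> = (\<Sum>v\<in>verts G.
      (\<Sum>e | e \<in> edges G \<and> tgt G e = v. edge_fun G f e (len G e) * lslope (edge_fun G g e) (len G e)))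
    - (\<Sum>v\<in>verts G. (\<Sum>e | e \<in> edges G \<and> src G e = v. edge_fun G f e 0 * rslope (edge_fun G g e) 0))"
    unfolding sum_subtractf[symmetric]
    using metric_graphD(6)[OF G]
    by (intro sum.cong) (auto simp: h_def lap_Vert right_diff_distrib sum_distrib_left edge_fun_simps
        intro!: arg_cong2[of _ _ _ _ minus] sum.cong)
  also have "\<dots> = (\<Sum>e\<in>edges G. edge_fun G f e (len G e) * lslope (edge_fun G g e) (len G e))
    - (\<Sum>e\<in>edges G. edge_fun G f e 0 * rslope (edge_fun G g e) 0)"
    using metric_graphD(4,5)[OF G] fin by (subst (1 2) sum.group) auto
  also have "sum h ((\<lambda>(e, t). EdgePt e t) ` I) = (\<Sum>(e, t)\<in>I. h (EdgePt e t))"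
    by (subst sum.reindex) (auto simp: inj_on_def case_prod_unfold)
  also have "\<dots> = (\<Sum>e\<in>edges G. \<Sum>t\<in>X e \<inter> {0<..<len G e}. h (EdgePt e t))"
    unfolding I_def using fin X by (subst sum.Sigma) auto
  also have "\<dots> = (\<Sum>e\<in>edges G. \<Sum>t\<in>X e \<inter> {0<..<len G e}.
      edge_fun G f e t * (lslope (edge_fun G g e) t - rslope (edge_fun G g e) t))"
    by (intro sum.cong) (auto simp: h_def lap_EdgePt edge_fun_simps)
  finally show "(\<Sum>p | lap G g p \<noteq> 0. f p * lap G g p) =
      (\<Sum>e\<in>edges G. edge_form (X e) 0 (len G e) (edge_fun G f e) (edge_fun G g e))"
    unfolding h_def edge_form_def by (simp add: sum.distrib sum_subtractf)
qed

lemma finite_support_lap: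
  assumes "metric_graph G" "cpa G g"
  shows "finite {p. lap G g p \<noteq> 0}"
  using cpa_breaks[OF assms(2,2)] sum_lap_eq_edge_form(1)[OF assms(1)] by metis

lemma lap_self_adjoint:
  assumes G: "metric_graph G" and f: "cpa G f" and g: "cpa G g"
  shows "(\<Sum>p | lap G g p \<noteq> 0. f p * lap G g p) = (\<Sum>p | lap G f p \<noteq> 0. g p * lap G f p)"
proof -
  obtain X where X: "\<And>e. e \<in> edges G \<Longrightarrow> finite (X e)"
    "\<And>e. e \<in> edges G \<Longrightarrow> affine_off UNIV (X e) 0 (len G e) (edge_fun G f e)"
    "\<And>e. e \<in> edges G \<Longrightarrow> affine_off UNIV (X e) 0 (len G e) (edge_fun G g e)"
    using cpa_breaks[OF f g] by metis
  have "(\<Sum>p | lap G g p \<noteq> 0. f p * lap G g p) =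
      (\<Sum>e\<in>edges G. edge_form (X e) 0 (len G e) (edge_fun G f e) (edge_fun G g e))"
    using sum_lap_eq_edge_form(2)[OF G X(1,3)] by simp
  also have "\<dots> = (\<Sum>e\<in>edges G. edge_form (X e) 0 (len G e) (edge_fun G g e) (edge_fun G f e))"
    using edge_form_sym[OF X(1) metric_graphD(6)[OF G] X(2,3)] by (intro sum.cong) auto
  also have "\<dots> = (\<Sum>p | lap G f p \<noteq> 0. g p * lap G f p)"
    using sum_lap_eq_edge_form(2)[OF G X(1,2)] by simp
  finally show ?thesis .
qed

text \<open>The vertices where \<open>g\<close> takes a given value are closed under passing along
  edges, so connectedness makes a nonempty such set everything.\<close>

lemma constant_if_constant_on_edges:
  assumes G: "metric_graph G"
    and const: "\<And>e t. e \<in> edges G \<Longrightarrow> t \<in> {0..len G e} \<Longrightarrow> edge_fun G g e t = edge_fun G g e 0"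
    and "p \<in> pts G" "q \<in> pts G"
  shows "g p = g q"
proof -
  have len: "0 < len G e" if "e \<in> edges G" for e using metric_graphD(6)[OF G that] .
  have "\<exists>v\<in>verts G. g r = g (Vert v)" if "r \<in> pts G" for r
    using that
  proof (cases rule: pts_cases)
    case (2 e t)
    then have "edge_fun G g e t = edge_fun G g e 0" by (intro const) auto
    then show ?thesis using 2 metric_graphD(4)[OF G] by (auto simp: edge_fun_simps)
  qed auto
  then obtain v w where vw: "v \<in> verts G" "w \<in> verts G" "g p = g (Vert v)" "g q = g (Vert w)"
    using assms(3,4) by metis
  have ends: "g (Vert (tgt G e)) = g (Vert (src G e))" if "e \<in> edges G" for e
    using const[OF that, of "len G e"] len[OF that] by (simp add: edge_fun_simps)
  have "{u \<in> verts G. g (Vert u) = g (Vert v)} = verts G"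
    using ends vw(1) metric_graphD(4,5)[OF G] by (intro metric_graph_connected[OF G]) auto
  then show ?thesis using vw by force
qed

text \<open>The hypothesis makes the Dirichlet energy of \<^term>\<open>g\<close> vanish.\<close>

lemma constant_if_lap_orthogonal:
  assumes G: "metric_graph G" and g: "cpa G g"
    and 0: "\<And>p. p \<in> pts G \<Longrightarrow> g p * lap G g p = 0"
    and "p \<in> pts G" "q \<in> pts G"
  shows "g p = g q"
proof -
  obtain X where X: "\<And>e. e \<in> edges G \<Longrightarrow> finite (X e)"
    "\<And>e. e \<in> edges G \<Longrightarrow> affine_off UNIV (X e) 0 (len G e) (edge_fun G g e)"
    using cpa_breaks[OF g g] by metis
  define E where "E e = edge_form (X e) 0 (len G e) (edge_fun G g e) (edge_fun G g e)" for e
  have E: "E e \<ge> 0 \<and> (E e = 0 \<longrightarrow> (\<forall>t\<in>{0..len G e}. edge_fun G g e t = edge_fun G g e 0))"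
    if "e \<in> edges G" for e
    unfolding E_def by (intro edge_form_self X that metric_graphD(6)[OF G])
  have "g p * lap G g p = 0" for p
    using 0 lap_outside by (cases "p \<in> pts G") auto
  then have "sum E (edges G) = 0"
    using sum_lap_eq_edge_form(2)[OF G X, of g] unfolding E_def by (simp only: sum.neutral_const)
  then have "E e = 0" if "e \<in> edges G" for e
    using that E sum_nonneg_eq_0_iff[of "edges G" E] metric_graphD(2)[OF G] by auto
  then show ?thesis
    using E assms(4,5) by (intro constant_if_constant_on_edges[OF G]) blast+
qed

section \<open>Existence and uniqueness of the Green function\<close>

text \<open>Gaussian elimination: an injective square system has a pivot in column \<open>k\<close>,
  and removing its row and column leaves a smaller injective square system.\<close>

lemma linear_system_solvable:
  fixes a :: "'i \<Rightarrow> 'j \<Rightarrow> real"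
  assumes "finite J" "finite I" "card I = card J"
    and "\<And>x. (\<And>i. i \<in> I \<Longrightarrow> (\<Sum>j\<in>J. a i j * x j) = 0) \<Longrightarrow> (\<And>j. j \<in> J \<Longrightarrow> x j = 0)"
  shows "\<exists>x. \<forall>i\<in>I. (\<Sum>j\<in>J. a i j * x j) = b i"
  using assms
proof (induction J arbitrary: I a b rule: finite_induct)
  case empty
  then show ?case by simp
next
  case (insert k J)
  have sum_insert: "(\<Sum>j\<in>insert k J. a i j * x j) = a i k * x k + (\<Sum>j\<in>J. a i j * x j)" for i and x :: "'j \<Rightarrow> real"
    using insert.hyps by simp
  have upd: "(\<Sum>j\<in>J. c j * (x(k := z)) j) = (\<Sum>j\<in>J. c j * x j)" for c x :: "'j \<Rightarrow> real" and z
    using insert.hyps by (intro sum.cong) auto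
  \<comment> \<open>A zero column would put the unit vector at \<open>k\<close> into the
    kernel.\<close>
  obtain l where l: "l \<in> I" "a l k \<noteq> 0"
  proof (rule ccontr)
    assume "\<not> thesis"
    then have "\<forall>i\<in>I. a i k = 0" using that by blast
    then have "(\<Sum>j\<in>insert k J. a i j * ((\<lambda>_. 0)(k := 1)) j) = 0" if "i \<in> I" for i
      using that unfolding sum_insert upd by simp
    from insert.prems(3)[OF this, of k] show False by simp
  qed
  define a' where "a' i j = a i j - a i k * a l j / a l k" for i j
  define b' where "b' i = b i - a i k * b l / a l k" for i
  have a': "(\<Sum>j\<in>J. a' i j * x j) = (\<Sum>j\<in>J. a i j * x j) - a i k / a l k * (\<Sum>j\<in>J. a l j * x j)" for i x
    unfolding a'_def by (simp add: left_diff_distrib sum_subtractf sum_distrib_left mult.assoc)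
  have "\<exists>x. \<forall>i\<in>I - {l}. (\<Sum>j\<in>J. a' i j * x j) = b' i"
  proof (rule insert.IH)
    show "finite (I - {l})" using insert.prems by simp
    show "card (I - {l}) = card J" using insert.prems insert.hyps l by simp
    fix x j assume x: "\<And>i. i \<in> I - {l} \<Longrightarrow> (\<Sum>j\<in>J. a' i j * x j) = 0" and j: "j \<in> J"
    \<comment> \<open>The entry at \<open>k\<close> is chosen so that row \<open>l\<close> holds;
      this extends a kernel vector of the reduced system to one of the full system.\<close>
    define y where "y = x(k := - (\<Sum>j\<in>J. a l j * x j) / a l k)"
    have "(\<Sum>j\<in>insert k J. a i j * y j) = 0" if "i \<in> I" for i
    proof (cases "i = l")
      case True
      then show ?thesis unfolding sum_insert unfolding y_def upd using l by simp
    next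
      case False
      then show ?thesis unfolding sum_insert unfolding y_def upd using x[of i] that l a'[of i x]
        by (simp add: algebra_simps)
    qed
    from insert.prems(3)[OF this, of j] show "x j = 0"
      using j insert.hyps unfolding y_def by (auto split: if_splits)
  qed
  then obtain x where x: "\<And>i. i \<in> I - {l} \<Longrightarrow> (\<Sum>j\<in>J. a' i j * x j) = b' i" by blast
  define y where "y = x(k := (b l - (\<Sum>j\<in>J. a l j * x j)) / a l k)"
  have "(\<Sum>j\<in>insert k J. a i j * y j) = b i" if "i \<in> I" for i
  proof (cases "i = l")
    case True
    then show ?thesis unfolding sum_insert unfolding y_def upd using l by simp
  next
    case False
    then show ?thesis unfolding sum_insert unfolding y_def upd using x[of i] that l a'[of i x]
      by (simp add: b'_def field_simps)
  qed
  then show ?case by blast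
qed

section \<open>Functions affine on every edge and the discrete Dirichlet problem\<close>

lemma cpa_sum:
  assumes "metric_graph G" "finite U" "\<And>u. u \<in> U \<Longrightarrow> cpa G (f u)"
  shows "cpa G (\<lambda>p. \<Sum>u\<in>U. f u p)"
  using assms(2,3)
proof (induction rule: finite_induct)
  case empty
  then show ?case using cpa_const[OF assms(1)] by simp
next
  case (insert u U)
  then show ?case using cpa_add[of G "f u"] by simp
qed

lemma lap_sum:
  assumes "metric_graph G" "finite U" "\<And>u. u \<in> U \<Longrightarrow> cpa G (f u)"
  shows "lap G (\<lambda>p. \<Sum>u\<in>U. f u p) p = (\<Sum>u\<in>U. lap G (f u) p)"
  using assms(2,3)
proof (induction rule: finite_induct)
  case empty
  then show ?case using lap_const by simp
next
  case (insert u U)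
  then show ?case
    using lap_add[OF assms(1), of "f u" "\<lambda>p. \<Sum>u\<in>U. f u p" p] cpa_sum[OF assms(1), of U f] by simp
qed

definition affine_extension :: "('v, 'e) mgraph \<Rightarrow> ('v \<Rightarrow> real) \<Rightarrow> ('v, 'e) point \<Rightarrow> real" where
  "affine_extension G F p = (case p of Vert v \<Rightarrow> F v
     | EdgePt e t \<Rightarrow> (F (tgt G e) - F (src G e)) / len G e * t + F (src G e))"

lemma edge_fun_affine_extension:
  assumes "metric_graph G" "e \<in> edges G"
  shows "\<forall>t\<in>{0..len G e}. edge_fun G (affine_extension G F) e t
    = (F (tgt G e) - F (src G e)) / len G e * t + F (src G e)"
  using metric_graphD(6)[OF assms] unfolding edge_fun_def pos_def affine_extension_def by auto

lemma cpa_affine_extension: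
  assumes "metric_graph G"
  shows "cpa G (affine_extension G F)"
  unfolding cpa_def
  using pw_affine_linear[OF metric_graphD(6)[OF assms] UNIV_I edge_fun_affine_extension[OF assms]] by blast

lemma lap_affine_extension_EdgePt:
  assumes "metric_graph G"
  shows "lap G (affine_extension G F) (EdgePt e t) = 0"
proof (cases "EdgePt e t \<in> pts G")
  case True
  then have et: "e \<in> edges G" "0 < t" "t < len G e" unfolding pts_def by auto
  have "affine_off UNIV {} 0 (len G e) (edge_fun G (affine_extension G F) e)"
    unfolding affine_off_def using edge_fun_affine_extension[OF assms et(1)] by fastforce
  then show ?thesis using lslope_eq_rslope_off et by (fastforce simp: lap_EdgePt)
qed (simp add: lap_outside)

text \<open>Expansion in hat functions, which turns the Laplacian on these functions into a matrix
  indexed by vertices.\<close>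

lemma affine_extension_eq_sum:
  assumes "metric_graph G" "p \<in> pts G"
  shows "affine_extension G F p
    = (\<Sum>u\<in>verts G. F u * affine_extension G (\<lambda>v. if v = u then 1 else 0) p)"
proof -
  have *: "(\<Sum>u\<in>verts G. F u * (if v = u then 1 else 0)) = F v" if "v \<in> verts G" for v
    using that metric_graphD(1)[OF assms(1)] by (simp add: if_distrib cong: if_cong)
  from assms(2) show ?thesis
  proof (cases rule: pts_cases)
    case (1 v)
    then show ?thesis using * by (simp add: affine_extension_def)
  next
    case (2 e t)
    have "(\<Sum>u\<in>verts G. F u * affine_extension G (\<lambda>v. if v = u then 1 else 0) p)
      = (\<Sum>u\<in>verts G. t / len G e * (F u * (if tgt G e = u then 1 else 0))
          + (1 - t / len G e) * (F u * (if src G e = u then 1 else 0)))"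
      using 2 by (intro sum.cong) (auto simp: affine_extension_def algebra_simps)
    also have "\<dots> = t / len G e * F (tgt G e) + (1 - t / len G e) * F (src G e)"
      unfolding sum.distrib sum_distrib_left[symmetric]
      by (simp only: *[OF metric_graphD(4)[OF assms(1) 2(1)]] *[OF metric_graphD(5)[OF assms(1) 2(1)]])
    also have "\<dots> = affine_extension G F p"
      using 2 by (simp add: affine_extension_def diff_divide_distrib algebra_simps)
    finally show ?thesis by simp
  qed
qed

lemma discrete_dirichlet_problem:
  assumes G: "metric_graph G" and w: "w \<in> verts G"
  obtains f where "cpa G f" "\<And>v. v \<in> verts G - {w} \<Longrightarrow> lap G f (Vert v) = \<phi> v"
    "\<And>e t. lap G f (EdgePt e t) = 0"
proof -
  let ?V = "verts G"
  define \<delta> where "\<delta> u = affine_extension G (\<lambda>v. if v = u then 1 else 0)" for u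
  \<comment> \<open>Constants lie in the kernel of the Laplacian matrix, so the row of
    \<open>w\<close> is replaced by one that fixes the value at \<open>w\<close>.\<close>
  define a where "a v u = (if v = w then (if u = w then 1 else 0) else lap G (\<delta> u) (Vert v))" for v u
  note fin = metric_graphD(1)[OF G]
  have lap_ext: "lap G (affine_extension G F) p = (\<Sum>u\<in>?V. F u * lap G (\<delta> u) p)" for F p
  proof -
    have "lap G (affine_extension G F) p = lap G (\<lambda>p. \<Sum>u\<in>?V. F u * \<delta> u p) p"
      unfolding \<delta>_def by (intro lap_cong[OF G] affine_extension_eq_sum[OF G])
    also have "\<dots> = (\<Sum>u\<in>?V. lap G (\<lambda>p. F u * \<delta> u p) p)"
      unfolding \<delta>_def by (intro lap_sum[OF G fin] cpa_cmult cpa_affine_extension[OF G])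
    also have "\<dots> = (\<Sum>u\<in>?V. F u * lap G (\<delta> u) p)"
      unfolding \<delta>_def by (intro sum.cong refl lap_cmult[OF G] cpa_affine_extension[OF G])
    finally show ?thesis .
  qed
  have a_w: "(\<Sum>u\<in>?V. a w u * F u) = F w" for F
    using w fin by (simp add: a_def if_distrib[of "\<lambda>x. x * _"] cong: if_cong)
  have a_v: "(\<Sum>u\<in>?V. a v u * F u) = lap G (affine_extension G F) (Vert v)" if "v \<noteq> w" for v F
    using that unfolding lap_ext a_def by (simp add: mult.commute)
  have "\<exists>F. \<forall>v\<in>?V. (\<Sum>u\<in>?V. a v u * F u) = \<phi> v"
  proof (rule linear_system_solvable[OF fin fin refl])
    fix F u assume F: "\<And>v. v \<in> ?V \<Longrightarrow> (\<Sum>u\<in>?V. a v u * F u) = 0" and u: "u \<in> ?V"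
    have Fw: "F w = 0" using F[OF w] a_w by simp
    have "affine_extension G F (Vert u) = affine_extension G F (Vert w)"
    proof (rule constant_if_lap_orthogonal[OF G cpa_affine_extension[OF G]])
      \<comment> \<open>At \<open>w\<close> the function vanishes; at other vertices and inside
        edges its Laplacian does. So the product is zero everywhere and the energy argument
        applies.\<close>
      fix p assume "p \<in> pts G"
      then show "affine_extension G F p * lap G (affine_extension G F) p = 0"
      proof (cases rule: pts_cases)
        case (1 v)
        then show ?thesis using F[of v] a_v[of v F] Fw by (cases "v = w") (auto simp: affine_extension_def)
      next
        case (2 e t)
        then show ?thesis by (simp add: lap_affine_extension_EdgePt[OF G])
      qed
    qed (use u w in \<open>auto simp: pts_def\<close>)
    then show "F u = 0" using Fw by (simp add: affine_extension_def)
  qed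
  then obtain F where F: "\<forall>v\<in>?V. (\<Sum>u\<in>?V. a v u * F u) = \<phi> v" by blast
  show ?thesis
    by (rule that[of "affine_extension G F"])
       (use F a_v cpa_affine_extension[OF G] lap_affine_extension_EdgePt[OF G] in auto)
qed

text \<open>Creates a unit mass inside an edge. The masses at vertices are left unspecified, to be
  corrected by a vertex problem, so zero serves when \<open>y\<close> is a vertex.\<close>

lemma tent_function:
  fixes G :: "('v, 'e) mgraph"
  assumes G: "metric_graph G" and y: "y \<in> pts G"
  obtains f where "cpa G f"
    "\<And>e t. EdgePt e t \<in> pts G \<Longrightarrow> lap G f (EdgePt e t) = (if EdgePt e t = y then 1 else 0)"
  using y
proof (cases rule: pts_cases)
  case (1 v)
  then show ?thesis using that[of "\<lambda>_. 0"] cpa_const[OF G] by (simp add: lap_const)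
next
  case (2 e0 t0)
  define L where "L = len G e0"
  \<comment> \<open>A tent vanishing at both ends with its peak at \<open>t0\<close>: the slopes
    \<open>(L - t0) / L\<close> and \<open>- t0 / L\<close> differ by exactly 1, and both formulas
    give \<open>t0 * (L - t0) / L\<close> at the peak.\<close>
  define f where "f p = (case p of Vert v \<Rightarrow> 0 | EdgePt e s \<Rightarrow> if e = e0 then
    (if s \<le> t0 then (L - t0) / L * s else - t0 / L * s + t0) else 0)" for p :: "('v, 'e) point"
  have L: "0 < t0" "t0 < L" using 2 unfolding L_def by auto
  have left: "\<forall>s\<in>{0..t0}. edge_fun G f e0 s = (L - t0) / L * s + 0"
    using L unfolding edge_fun_def pos_def f_def L_def by auto
  have right: "\<forall>s\<in>{t0..L}. edge_fun G f e0 s = - t0 / L * s + t0"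
    using L unfolding edge_fun_def pos_def f_def L_def by (auto simp: field_simps)
  have other: "\<forall>s\<in>{0..len G e}. edge_fun G f e s = 0 * s + 0" if "e \<noteq> e0" for e
    using that unfolding edge_fun_def pos_def f_def by auto
  have "pw_affine UNIV 0 (len G e) (edge_fun G f e)" if e: "e \<in> edges G" for e
  proof (cases "e = e0")
    case True
    then show ?thesis
      using pw_affine_join[OF pw_affine_linear[OF L(1) UNIV_I left] pw_affine_linear[OF L(2) UNIV_I right]]
      unfolding L_def by simp
  next
    case False
    then show ?thesis using pw_affine_linear[OF metric_graphD(6)[OF G e] UNIV_I other] by blast
  qed
  then have "cpa G f" unfolding cpa_def by blast
  moreover have "lap G f (EdgePt e t) = (if EdgePt e t = y then 1 else 0)"
    if p: "EdgePt e t \<in> pts G" for e t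
  proof -
    have et: "e \<in> edges G" "0 < t" "t < len G e" using p unfolding pts_def by auto
    have slopes: "lap G f (EdgePt e t) = m - n"
      if "u < t" "t < v" "\<forall>s\<in>{u..t}. edge_fun G f e s = m * s + c"
        "\<forall>s\<in>{t..v}. edge_fun G f e s = n * s + d" for m n c d u v
      using lslope_affine[OF that(1,3)] rslope_affine[OF that(2,4)] et by (simp add: lap_EdgePt)
    consider "e \<noteq> e0" | "e = e0" "t < t0" | "e = e0" "t = t0" | "e = e0" "t0 < t" by linarith
    then show ?thesis
    proof cases
      case 1
      then show ?thesis using slopes[of 0 "len G e" 0 0 0 0] other[OF 1] et \<open>y = EdgePt e0 t0\<close> 1 by auto
    next
      case 2
      then have "lap G f (EdgePt e t) = (L - t0) / L - (L - t0) / L"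
        using left et by (intro slopes[of 0 t0 _ 0 _ 0]) auto
      then show ?thesis using 2 \<open>y = EdgePt e0 t0\<close> by simp
    next
      case 3
      have "lap G f (EdgePt e t) = (L - t0) / L - (- t0 / L)"
        using left right L 3 by (intro slopes[of 0 L _ 0 _ t0]) auto
      also have "\<dots> = 1" using L by (simp add: field_simps)
      finally show ?thesis using 3 \<open>y = EdgePt e0 t0\<close> by simp
    next
      case 4
      then have "lap G f (EdgePt e t) = - t0 / L - (- t0 / L)"
        using right et L_def by (intro slopes[of t0 L _ t0 _ t0]) auto
      then show ?thesis using 4 \<open>y = EdgePt e0 t0\<close> by simp
    qed
  qed
  ultimately show ?thesis using that by blast
qed

lemma sum_lap_eq_0:
  assumes G: "metric_graph G" and g: "cpa G g"
  shows "(\<Sum>p | lap G g p \<noteq> 0. lap G g p) = 0"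
  using lap_self_adjoint[OF G cpa_const[OF G, of 1] g] by (simp add: lap_const)

text \<open>The condition under the description in \<open>jfun\<close>, given a name. Prescribing 0
  off the graph pins the function down on the whole type.\<close>

definition is_green_function ::
    "('v, 'e) mgraph \<Rightarrow> ('v, 'e) point \<Rightarrow> ('v, 'e) point \<Rightarrow> (('v, 'e) point \<Rightarrow> real) \<Rightarrow> bool" where
  "is_green_function G q y g \<longleftrightarrow> cpa G g \<and>
     (\<forall>p \<in> pts G. lap G g p = (if p = y then 1 else 0) - (if p = q then 1 else 0)) \<and>
     g q = 0 \<and> (\<forall>p. p \<notin> pts G \<longrightarrow> g p = 0)"

lemma lap_green_function:
  assumes "is_green_function G q y g" "q \<in> pts G" "y \<in> pts G"
  shows "lap G g p = (if p = y then 1 else 0) - (if p = q then 1 else 0)"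
  using assms lap_outside unfolding is_green_function_def by (cases "p \<in> pts G") auto

text \<open>A difference of two tents has the right masses inside edges, \<open>R\<close> repairs
  every vertex except \<open>w\<close>, and total mass zero settles \<open>w\<close>.\<close>

lemma green_function_exists:
  assumes G: "metric_graph G" and q: "q \<in> pts G" and y: "y \<in> pts G"
  obtains g where "is_green_function G q y g"
proof -
  obtain S where S: "cpa G S"
    "\<And>e t. EdgePt e t \<in> pts G \<Longrightarrow> lap G S (EdgePt e t) = (if EdgePt e t = q then 1 else 0)"
    using tent_function[OF G q] by metis
  obtain T where T: "cpa G T"
    "\<And>e t. EdgePt e t \<in> pts G \<Longrightarrow> lap G T (EdgePt e t) = (if EdgePt e t = y then 1 else 0)"
    using tent_function[OF G y] by metis
  define \<rho> where "\<rho> p = (if p = y then 1 else 0) - (if p = q then 1 else 0 :: real)" for p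
  obtain w where w: "w \<in> verts G" using metric_graphD(3)[OF G] by blast
  obtain R where R: "cpa G R"
    "\<And>v. v \<in> verts G - {w} \<Longrightarrow> lap G R (Vert v) = \<rho> (Vert v) - lap G T (Vert v) + lap G S (Vert v)"
    "\<And>e t. lap G R (EdgePt e t) = 0"
    using discrete_dirichlet_problem[OF G w, of "\<lambda>v. \<rho> (Vert v) - lap G T (Vert v) + lap G S (Vert v)"] by metis
  define h where "h p = (T p + -1 * S p) + R p" for p
  have TS: "cpa G (\<lambda>p. T p + -1 * S p)" by (intro cpa_add cpa_cmult S T)
  have h: "cpa G h" unfolding h_def by (intro cpa_add[OF TS] R)
  have lap_h: "lap G h p = lap G T p - lap G S p + lap G R p" for p
    unfolding h_def lap_add[OF G TS R(1)] lap_add[OF G T(1) cpa_cmult[OF S(1)]] lap_cmult[OF G S(1)]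
    by simp
  have off_w: "lap G h p = \<rho> p" if "p \<noteq> Vert w" for p
  proof (cases "p \<in> pts G")
    case True
    then show ?thesis
    proof (cases rule: pts_cases)
      case (1 v)
      then show ?thesis using that R(2)[of v] by (auto simp: lap_h)
    next
      case (2 e t)
      then show ?thesis using True S(2) T(2) R(3) by (simp add: lap_h \<rho>_def)
    qed
  next
    case False
    then show ?thesis using q y by (auto simp: lap_outside \<rho>_def)
  qed
  \<comment> \<open>Besides the support it contains \<open>y\<close> and \<open>q\<close>, so that
    \<open>\<rho>\<close> sums to zero over it, and \<open>Vert w\<close>, the one point still
    open.\<close>
  define A where "A = {p. lap G h p \<noteq> 0} \<union> {y, q, Vert w}"
  have A: "finite A" unfolding A_def using finite_support_lap[OF G h] by simp
  have "sum (lap G h) A = (\<Sum>p | lap G h p \<noteq> 0. lap G h p)"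
    using A by (intro sum.mono_neutral_right) (auto simp: A_def)
  then have "sum (lap G h) A = 0" using sum_lap_eq_0[OF G h] by (rule trans)
  moreover have "sum \<rho> A = 0"
    unfolding \<rho>_def sum_subtractf sum.delta[OF A] sum.delta'[OF A] by (simp add: A_def)
  moreover have "sum (lap G h) A = lap G h (Vert w) + sum (lap G h) (A - {Vert w})"
    "sum \<rho> A = \<rho> (Vert w) + sum \<rho> (A - {Vert w})"
    by (intro sum.remove[OF A]; simp add: A_def)+
  moreover have "sum (lap G h) (A - {Vert w}) = sum \<rho> (A - {Vert w})"
    using off_w by (intro sum.cong) auto
  ultimately have lap_h_eq: "lap G h p = \<rho> p" for p
    using off_w[of p] by (cases "p = Vert w") auto
  define g where "g p = (if p \<in> pts G then h p + - h q else 0)" for p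
  have g: "\<And>p. p \<in> pts G \<Longrightarrow> g p = h p + - h q" unfolding g_def by simp
  have "cpa G g"
    using cpa_cong[OF G, of g "\<lambda>p. h p + - h q"] g cpa_add[OF h cpa_const[OF G]] by blast
  moreover have "lap G g p = \<rho> p" for p
    using lap_cong[OF G, of g "\<lambda>p. h p + - h q" p] g lap_add[OF G h cpa_const[OF G], of "- h q" p]
      lap_const[of G "- h q" p] lap_h_eq[of p] by simp
  moreover have "g q = 0" "\<forall>p. p \<notin> pts G \<longrightarrow> g p = 0" unfolding g_def using q by auto
  ultimately have "is_green_function G q y g" unfolding is_green_function_def \<rho>_def by blast
  then show ?thesis using that by blast
qed

text \<open>The difference of two candidates is harmonic, hence constant, and it vanishes at
  \<open>q\<close>.\<close>

lemma green_function_unique: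
  assumes G: "metric_graph G" and q: "q \<in> pts G"
    and f: "is_green_function G q y f" and g: "is_green_function G q y g"
  shows "f = g"
proof
  fix p
  define h where "h p = f p + -1 * g p" for p
  have cpa: "cpa G f" "cpa G g" using f g unfolding is_green_function_def by auto
  then have h: "cpa G h" unfolding h_def by (intro cpa_add cpa_cmult)
  have "lap G h p = 0" if "p \<in> pts G" for p
    unfolding h_def lap_add[OF G cpa(1) cpa_cmult[OF cpa(2)]] lap_cmult[OF G cpa(2)]
    using f g that unfolding is_green_function_def by simp
  then have "h p = h q" if "p \<in> pts G"
    using constant_if_lap_orthogonal[OF G h _ that q] by simp
  then show "f p = g p"
    using f g unfolding h_def is_green_function_def by (cases "p \<in> pts G") auto
qed

lemma is_green_function_jfun:
  assumes "metric_graph G" "q \<in> pts G" "y \<in> pts G"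
  shows "is_green_function G q y (\<lambda>x. jfun G q x y)"
proof -
  have "jfun G q x y = (THE g. is_green_function G q y g) x" for x
    unfolding jfun_def is_green_function_def ..
  moreover have "\<exists>!g. is_green_function G q y g"
    using green_function_exists[OF assms] green_function_unique[OF assms(1,2)] by metis
  ultimately show ?thesis using theI'[of "is_green_function G q y"] by presburger
qed

lemma jfun_at_q:
  assumes "metric_graph G" "q \<in> pts G" "y \<in> pts G"
  shows "jfun G q q y = 0"
  using is_green_function_jfun[OF assms] unfolding is_green_function_def by blast

lemma cpa_jfun:
  assumes "metric_graph G" "q \<in> pts G" "y \<in> pts G"
  shows "cpa G (\<lambda>x. jfun G q x y)"
  using is_green_function_jfun[OF assms] unfolding is_green_function_def by blast

section \<open>Reproducing property and symmetry of the Green function\<close>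

lemma sum_lap_jfun:
  assumes "metric_graph G" "q \<in> pts G" "y \<in> pts G"
  shows "(\<Sum>p | lap G (\<lambda>x. jfun G q x y) p \<noteq> 0. f p * lap G (\<lambda>x. jfun G q x y) p) = f y - f q"
proof -
  have lap: "lap G (\<lambda>x. jfun G q x y) p = (if p = y then 1 else 0) - (if p = q then 1 else 0)" for p
    using lap_green_function[OF is_green_function_jfun[OF assms] assms(2,3)] .
  show ?thesis
  proof (cases "y = q")
    case False
    then have "{p. lap G (\<lambda>x. jfun G q x y) p \<noteq> 0} = {y, q}" by (auto simp: lap)
    then show ?thesis using False by (simp add: lap)
  next
    case True
    then have "lap G (\<lambda>x. jfun G q x y) p = 0" for p using lap[of p] by simp
    then show ?thesis using True by simp
  qed
qed

text \<open>Self-adjointness moves the Laplacian from \<open>f\<close> to the Green function, whose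
  Laplacian is the unit mass at \<open>y\<close> minus that at \<open>q\<close>.\<close>

lemma sum_jfun_lap:
  assumes "metric_graph G" "q \<in> pts G" "y \<in> pts G" "cpa G f"
  shows "(\<Sum>p | lap G f p \<noteq> 0. jfun G q p y * lap G f p) = f y - f q"
  using sum_lap_jfun[OF assms(1-3), of f] lap_self_adjoint[OF assms(1) cpa_jfun[OF assms(1-3)] assms(4)]
  by simp

text \<open>The pairing of \<open>jfun G q p y\<close> with the Laplacian of
  \<open>jfun G q p x\<close> in \<open>p\<close> is evaluated by both preceding formulas; the terms
  at \<open>q\<close> vanish.\<close>

lemma jfun_sym:
  assumes "metric_graph G" "q \<in> pts G" "x \<in> pts G" "y \<in> pts G"
  shows "jfun G q x y = jfun G q y x"
  using sum_jfun_lap[OF assms(1,2,4) cpa_jfun[OF assms(1,2,3)]]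
    sum_lap_jfun[OF assms(1,2,3), of "\<lambda>p. jfun G q p y"] jfun_at_q[OF assms(1,2)] assms(3,4)
  by simp

section \<open>The energy of linearly equivalent divisors\<close>

lemma continuous_on_edge_fun:
  assumes "cpa G f" "e \<in> edges G"
  shows "continuous_on {0..len G e} (edge_fun G f e)"
  using pw_affine_continuous_on[OF cpaD[OF assms]] .

text \<open>The multiple of \<^term>\<open>q\<close> subtracted in \<^const>\<open>bq\<close> is irrelevant because
  \<^prop>\<open>jfun G q q y = 0\<close>.\<close>

lemma bq_eq:
  assumes G: "metric_graph G" and q: "q \<in> pts G"
    and A: "finite A" "{p. D p \<noteq> 0} \<subseteq> A"
  shows "bq G q D = (\<Sum>e\<in>edges G. integral {0..len G e}
    (\<lambda>t. \<Sum>x\<in>A. real_of_int (D x) * jfun G q x (pos G e t)))"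
proof -
  define Dq where "Dq p = D p - (if p = q then deg D else 0)" for p
  have inner: "(\<Sum>x | Dq x \<noteq> 0. real_of_int (Dq x) * jfun G q x y)
      = (\<Sum>x\<in>A. real_of_int (D x) * jfun G q x y)" if y: "y \<in> pts G" for y
  proof -
    have "(\<Sum>x | Dq x \<noteq> 0. real_of_int (Dq x) * jfun G q x y)
        = (\<Sum>x\<in>insert q A. real_of_int (Dq x) * jfun G q x y)"
      using A by (intro sum.mono_neutral_left) (auto simp: Dq_def)
    also have "\<dots> = (\<Sum>x\<in>insert q A. real_of_int (D x) * jfun G q x y)"
      using jfun_at_q[OF G q y] by (intro sum.cong) (auto simp: Dq_def)
    also have "\<dots> = (\<Sum>x\<in>A. real_of_int (D x) * jfun G q x y)"
      using A jfun_at_q[OF G q y] by (intro sum.mono_neutral_right) auto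
    finally show ?thesis .
  qed
  show ?thesis
    unfolding bq_def Let_def Dq_def[symmetric] by (simp add: inner pos_in_pts[OF G] cong: sum.cong)
qed

text \<open>In the definition of \<open>jfun\<close> the second argument is a mere parameter, with
  no regularity in sight. Symmetry makes it the first argument, in which the function is continuous
  on every edge.\<close>

lemma integrable_jfun_sum:
  assumes G: "metric_graph G" and q: "q \<in> pts G" and A: "A \<subseteq> pts G" and e: "e \<in> edges G"
  shows "(\<lambda>t. \<Sum>x\<in>A. c x * jfun G q x (pos G e t)) integrable_on {0..len G e}"
proof -
  have "(\<lambda>t. \<Sum>x\<in>A. c x * jfun G q x (pos G e t))
      = (\<lambda>t. \<Sum>x\<in>A. c x * edge_fun G (\<lambda>z. jfun G q z x) e t)"
    using jfun_sym[OF G q _ pos_in_pts[OF G e]] A unfolding edge_fun_def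
    by (intro ext sum.cong) auto
  moreover have "continuous_on {0..len G e} (\<lambda>t. \<Sum>x\<in>A. c x * edge_fun G (\<lambda>z. jfun G q z x) e t)"
    using A by (intro continuous_intros continuous_on_edge_fun[OF cpa_jfun[OF G q] e]) auto
  ultimately show ?thesis using integrable_continuous_real by metis
qed

lemma bq_diff:
  assumes G: "metric_graph G" and q: "q \<in> pts G"
    and D: "is_divisor G D" and E: "is_divisor G E" and f: "cpa G f"
    and ED: "\<And>p. real_of_int (E p) = real_of_int (D p) + lap G f p"
  shows "bq G q E - bq G q D
    = (\<Sum>e\<in>edges G. integral {0..len G e} (\<lambda>t. edge_fun G f e t - f q))"
proof -
  \<comment> \<open>One finite set carrying both divisors, and with them the Laplacian of
    \<open>f\<close>, so that the two sums subtract termwise.\<close>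
  define A where "A = {p. D p \<noteq> 0} \<union> {p. E p \<noteq> 0}"
  have A: "finite A" "A \<subseteq> pts G" "{p. D p \<noteq> 0} \<subseteq> A" "{p. E p \<noteq> 0} \<subseteq> A"
    using D E unfolding A_def is_divisor_def by auto
  have supp: "lap G f p = 0" if "p \<notin> A" for p
    using ED[of p] that unfolding A_def by simp
  have diff: "(\<Sum>x\<in>A. real_of_int (E x) * jfun G q x y) - (\<Sum>x\<in>A. real_of_int (D x) * jfun G q x y)
      = f y - f q" if y: "y \<in> pts G" for y
  proof -
    have "(\<Sum>x\<in>A. real_of_int (E x) * jfun G q x y) - (\<Sum>x\<in>A. real_of_int (D x) * jfun G q x y)
        = (\<Sum>x\<in>A. jfun G q x y * lap G f x)"
      unfolding sum_subtractf[symmetric] ED by (intro sum.cong) (auto simp: algebra_simps)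
    also have "\<dots> = (\<Sum>x | lap G f x \<noteq> 0. jfun G q x y * lap G f x)"
      using A(1) supp by (intro sum.mono_neutral_right) auto
    finally show ?thesis using sum_jfun_lap[OF G q y f] by simp
  qed
  have "bq G q E - bq G q D = (\<Sum>e\<in>edges G. integral {0..len G e}
      (\<lambda>t. (\<Sum>x\<in>A. real_of_int (E x) * jfun G q x (pos G e t))
        - (\<Sum>x\<in>A. real_of_int (D x) * jfun G q x (pos G e t))))"
    unfolding bq_eq[OF G q A(1,3)] bq_eq[OF G q A(1,4)]
    by (subst sum_subtractf[symmetric])
       (intro sum.cong refl integral_diff[symmetric] integrable_jfun_sum[OF G q A(2)])
  also have "\<dots> = (\<Sum>e\<in>edges G. integral {0..len G e} (\<lambda>t. edge_fun G f e t - f q))"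
    unfolding edge_fun_def using diff pos_in_pts[OF G] by (intro sum.cong integral_cong) auto
  finally show ?thesis .
qed

text \<open>The integrands are continuous and nonnegative. If all integrals vanished, so would the
  integrands, and connectedness would make \<open>f\<close> constant.\<close>

lemma sum_integral_pos:
  assumes G: "metric_graph G" and f: "cpa G f" and q: "q \<in> pts G"
    and ge: "\<And>x. x \<in> pts G \<Longrightarrow> f q \<le> f x"
    and x: "x \<in> pts G" "y \<in> pts G" "f x \<noteq> f y"
  shows "0 < (\<Sum>e\<in>edges G. integral {0..len G e} (\<lambda>t. edge_fun G f e t - f q))"
proof -
  define I where "I e = integral {0..len G e} (\<lambda>t. edge_fun G f e t - f q)" for e
  have nonneg: "0 \<le> edge_fun G f e t - f q" if "e \<in> edges G" for e t
    using ge[OF pos_in_pts[OF G that]] unfolding edge_fun_def by simp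
  have cont: "continuous_on {0..len G e} (\<lambda>t. edge_fun G f e t - f q)" if "e \<in> edges G" for e
    by (intro continuous_intros continuous_on_edge_fun[OF f that])
  have I: "0 \<le> I e" if "e \<in> edges G" for e
    unfolding I_def using nonneg[OF that] by (intro integral_nonneg integrable_continuous_real cont that)
  have "sum I (edges G) \<noteq> 0"
  proof
    assume "sum I (edges G) = 0"
    then have "I e = 0" if "e \<in> edges G" for e
      using that I sum_nonneg_eq_0_iff[of "edges G" I] metric_graphD(2)[OF G] by auto
    then have "\<forall>t\<in>{0..len G e}. edge_fun G f e t - f q = 0" if "e \<in> edges G" for e
      using integral_eq_0_iff[OF cont[OF that] metric_graphD(6)[OF G that] nonneg[OF that]] that
      unfolding I_def by blast
    then have "edge_fun G f e t = edge_fun G f e 0" if "e \<in> edges G" "t \<in> {0..len G e}" for e t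
      using that metric_graphD(6)[OF G that(1)] by (metis atLeastAtMost_iff eq_iff_diff_eq_0 less_imp_le order_refl)
    then have "f x = f y" using constant_if_constant_on_edges[OF G _ x(1,2)] by metis
    then show False using x(3) by simp
  qed
  then show ?thesis using sum_nonneg[of "edges G" I] I unfolding I_def by fastforce
qed

section \<open>Truncation and reduced divisors\<close>

lemma rational_fun_min_const:
  assumes "rational_fun G f"
  shows "rational_fun G (\<lambda>p. min (f p) k)"
  unfolding rational_fun_def
proof
  fix e assume "e \<in> edges G"
  then have "pw_affine \<int> 0 (len G e) (edge_fun G f e)" using assms unfolding rational_fun_def by blast
  from pw_affine_min_const[OF this, of k]
  show "pw_affine \<int> 0 (len G e) (edge_fun G (\<lambda>p. min (f p) k) e)" unfolding edge_fun_def by simp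
qed

text \<open>Truncating \<^term>\<open>f\<close> at height \<^term>\<open>k\<close>, each point keeps enough chips: where the
  truncation touches \<^term>\<open>f\<close> its Laplacian is at least that of \<^term>\<open>f\<close>, and where it
  touches the constant \<^term>\<open>k\<close> it is nonnegative.\<close>

lemma lap_min_const_ge:
  assumes G: "metric_graph G" and f: "rational_fun G f" and p: "p \<in> pts G"
  shows "min 0 (lap G f p) \<le> lap G (\<lambda>p. min (f p) k) p"
proof (cases "f p \<le> k")
  case True
  then have "lap G f p \<le> lap G (\<lambda>p. min (f p) k) p"
    by (intro lap_antimono G rational_fun_imp_cpa rational_fun_min_const f p) auto
  then show ?thesis by simp
next
  case False
  then have "lap G (\<lambda>p. k) p \<le> lap G (\<lambda>p. min (f p) k) p"
    by (intro lap_antimono G cpa_const rational_fun_imp_cpa rational_fun_min_const f p) auto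
  then show ?thesis by (simp add: lap_const)
qed

lemma q_reduced_imp_minimum:
  assumes G: "metric_graph G" and q: "q \<in> pts G" and D: "is_divisor G D" and red: "q_reduced G q D"
    and f: "rational_fun G f"
    and E: "\<And>p. p \<in> pts G - {q} \<Longrightarrow> 0 \<le> real_of_int (D p) + lap G f p"
    and x: "x \<in> pts G"
  shows "f q \<le> f x"
proof (rule ccontr)
  assume less: "\<not> f q \<le> f x"
  define g where "g p = min (f p) (f q)" for p
  \<comment> \<open>The floor only changes the type: by \<open>lap_rational_Ints\<close> nothing is
    rounded.\<close>
  define E' where "E' p = D p + \<lfloor>lap G g p\<rfloor>" for p
  have g: "rational_fun G g" unfolding g_def by (rule rational_fun_min_const[OF f])
  have E': "real_of_int (E' p) = real_of_int (D p) + lap G g p" for p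
    using lap_rational_Ints[OF G g, of p] unfolding E'_def by (auto elim: Ints_cases)
  have supp: "{p. E' p \<noteq> 0} \<subseteq> {p. D p \<noteq> 0} \<union> {p. lap G g p \<noteq> 0}" unfolding E'_def by auto
  then have "finite {p. E' p \<noteq> 0}"
    using D finite_support_lap[OF G rational_fun_imp_cpa[OF g]] finite_subset
    unfolding is_divisor_def by blast
  moreover have "{p. E' p \<noteq> 0} \<subseteq> pts G"
    using supp D lap_outside unfolding is_divisor_def by blast
  ultimately have "is_divisor G E'" unfolding is_divisor_def by blast
  moreover have "lin_equiv G E' D" unfolding lin_equiv_def using g E' by (intro exI[of _ g]) simp
  \<comment> \<open>The new coefficient is at least the smaller of \<open>D p\<close> and
    \<open>D p + lap G f p\<close>, both nonnegative off \<open>q\<close>.\<close>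
  moreover have "0 \<le> E' p" if p: "p \<in> pts G - {q}" for p
  proof -
    have "0 \<le> D p" using red p unfolding q_reduced_def by blast
    then have "0 \<le> real_of_int (D p)" by simp
    then have "0 \<le> real_of_int (E' p)"
      using E[OF p] lap_min_const_ge[OF G f, of p "f q"] p
      unfolding E' g_def[abs_def] by (auto simp: min_def split: if_splits)
    then show ?thesis by simp
  qed
  ultimately have "E' \<in> linsys G q D" unfolding linsys_def by blast
  moreover have "\<exists>x\<in>pts G. \<exists>y\<in>pts G. g x \<noteq> g y"
    using less x q unfolding g_def by (intro bexI[of _ x] bexI[of _ q]) auto
  moreover have "\<forall>x\<in>pts G. g x \<le> g q" unfolding g_def by auto
  ultimately show False using red g E' unfolding q_reduced_def by blast
qed

theorem mainTheorem20:
  fixes G :: "('v, 'e) mgraph" and q :: "('v, 'e) point" and D :: "('v, 'e) point \<Rightarrow> int"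
  assumes "metric_graph G"
    and "q \<in> pts G"
    and "is_divisor G D"
    and "\<forall>p \<in> pts G - {q}. D p \<ge> 0"
  shows "q_reduced G q D \<longleftrightarrow>
           (\<forall>D' \<in> linsys G q D. D' \<noteq> D \<longrightarrow> bq G q D < bq G q D')"
proof (intro iffI ballI impI)
  note G = assms(1) and q = assms(2) and D = assms(3)
  fix D' assume red: "q_reduced G q D" and D': "D' \<in> linsys G q D" "D' \<noteq> D"
  obtain f where f: "rational_fun G f" "\<And>p. real_of_int (D' p - D p) = lap G f p"
    using D'(1) unfolding linsys_def lin_equiv_def by blast
  have D'_eq: "real_of_int (D' p) = real_of_int (D p) + lap G f p" for p
    using f(2)[of p] by simp
  have "f q \<le> f x" if "x \<in> pts G" for x
  proof (rule q_reduced_imp_minimum[OF G q D red f(1) _ that])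
    fix p assume "p \<in> pts G - {q}"
    then have "0 \<le> D' p" using D'(1) unfolding linsys_def by blast
    then show "0 \<le> real_of_int (D p) + lap G f p" unfolding D'_eq[symmetric] by simp
  qed
  \<comment> \<open>If \<open>f\<close> were constant, its Laplacian would vanish and
    \<open>D'\<close> would be \<open>D\<close>.\<close>
  moreover obtain x where "x \<in> pts G" "f x \<noteq> f q"
  proof (rule ccontr)
    assume "\<not> thesis"
    then have "\<And>p. p \<in> pts G \<Longrightarrow> f p = f q" using that by blast
    then have "lap G f p = 0" for p
      using lap_cong[OF G, of f "\<lambda>_. f q" p] by (simp add: lap_const)
    then have "D' p = D p" for p using D'_eq[of p] by simp
    then show False using D'(2) by blast
  qed
  moreover have "is_divisor G D'" using D'(1) unfolding linsys_def by blast
  ultimately show "bq G q D < bq G q D'"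
    using bq_diff[OF G q D _ rational_fun_imp_cpa[OF f(1)] D'_eq]
      sum_integral_pos[OF G rational_fun_imp_cpa[OF f(1)] q _ _ q] by fastforce
next
  note G = assms(1) and q = assms(2) and D = assms(3)
  assume min: "\<forall>D' \<in> linsys G q D. D' \<noteq> D \<longrightarrow> bq G q D < bq G q D'"
  have False
    if f: "rational_fun G f" and nonconst: "x \<in> pts G" "y \<in> pts G" "f x \<noteq> f y"
      and max: "\<And>x. x \<in> pts G \<Longrightarrow> f x \<le> f q"
      and E: "E \<in> linsys G q D" "\<And>p. real_of_int (E p) = real_of_int (D p) + lap G f p" for f x y E
  proof -
    note cpa = rational_fun_imp_cpa[OF f]
    \<comment> \<open>Negation makes \<open>q\<close> a minimum and reverses the roles:
      \<open>D\<close> arises from \<open>E\<close> by adding the Laplacian of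
      \<open>g\<close>.\<close>
    define g where "g p = -1 * f p" for p
    have g: "cpa G g" unfolding g_def by (rule cpa_cmult[OF cpa])
    \<comment> \<open>Equality would make \<open>f\<close> harmonic, hence constant. Distinctness is
      what lets the minimality assumption be applied to \<open>E\<close>.\<close>
    have "E \<noteq> D"
    proof
      assume "E = D"
      then have "lap G f p = 0" for p using E(2)[of p] by simp
      then show False using constant_if_lap_orthogonal[OF G cpa _ nonconst(1,2)] nonconst(3) by simp
    qed
    then have "bq G q D < bq G q E" using min E(1) by blast
    moreover have "bq G q E < bq G q D"
    proof -
      have "real_of_int (D p) = real_of_int (E p) + lap G g p" for p
        using E(2)[of p] lap_cmult[OF G cpa, of "-1" p] unfolding g_def[abs_def] by simp
      moreover have "is_divisor G E" using E(1) unfolding linsys_def by blast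
      ultimately have "bq G q D - bq G q E
          = (\<Sum>e\<in>edges G. integral {0..len G e} (\<lambda>t. edge_fun G g e t - g q))"
        by (intro bq_diff G q D g)
      also have "\<dots> > 0"
        by (rule sum_integral_pos[OF G g q _ nonconst(1,2)]) (use max nonconst(3) in \<open>auto simp: g_def\<close>)
      finally show ?thesis by simp
    qed
    ultimately show False by simp
  qed
  then show "q_reduced G q D" unfolding q_reduced_def using assms(4) by blast
qed

end
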